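(* The normalized Haar system $(h_I/\|h_I\|_{L^1})_{I\in\mathcal D^+}$ of $L^1=L^1[0,1]$ has the $1/\delta$-factorization property.
   Context: $\mathcal D$ is the set of dyadic intervals $[\frac{i-1}{2^j},\frac{i}{2^j})$, $j\ge0$, $1\le i\le2^j$; for $I\in\mathcal D$ with left half $I^+$ and right half $I^-$, $h_I=\chi_{I^+}-\chi_{I^-}$. $\mathcal D^+=\mathcal D\cup\{\emptyset\}$, $h_\emptyset=\chi_{[0,1)}$. Ordered with $\emptyset$ first and then $\mathcal D$ by $[\frac{i-1}{2^j},\frac i{2^j})\mapsto2^j+i-1$, $(h_I)_{I\in\mathcal D^+}$ is a monotone Schauder basis of the real space $L^1$. For a bounded linear operator $T:X\to X$ and $K>0$, the identity $K$-factors through $T$ if there are bounded linear $R,S:X\to X$ with $\|R\|\|S\|\le K$ and $I=STR$; it almost $K$-factors through $T$ if it $(K+\varepsilon)$-factors through $T$ for all $\varepsilon>0$. Given $K:(0,\infty)\to\mathbb R$, a normalized Schauder basis $(e_n)$ of $X$ with biorthogonal functionals $(e_n^* )$ has the $K(\delta)$-factorization property if for every $\delta>0$ and every bounded linear operator $T:X\to X$ with $\inf_n|e_n^*(T(e_n))|\ge\delta$, the identity almost $K(\delta)$-factors through $T$. Here $K(\delta)=1/\delta$. *)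

theory Defs
  imports "HOL-Analysis.Analysis" "HOL-Library.Discrete_Functions"
begin

abbreviation unit_leb :: "real measure"
  where "unit_leb \<equiv> lebesgue_on {0..1}"

quotient_type L1 = "real \<Rightarrow> real" / partial:
  "\<lambda>f g. integrable unit_leb f \<and> integrable unit_leb g \<and> (AE x in unit_leb. f x = g x)"
  morphisms rep_L1 L1_class
proof (rule part_equivpI)
  show "\<exists>f. integrable unit_leb f \<and> integrable unit_leb f \<and> (AE x in unit_leb. f x = f x)"
    by (rule exI[of _ "\<lambda>_. 0"]) simp
  show "symp (\<lambda>f g. integrable unit_leb f \<and> integrable unit_leb g \<and> (AE x in unit_leb. f x = g x))"
    by (auto intro!: sympI elim: AE_mp)
  show "transp (\<lambda>f g. integrable unit_leb f \<and> integrable unit_leb g \<and> (AE x in unit_leb. f x = g x))"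
    by (rule transpI) auto
qed

instantiation L1 :: real_vector
begin

lift_definition zero_L1 :: L1 is "\<lambda>_. 0" by simp

lift_definition plus_L1 :: "L1 \<Rightarrow> L1 \<Rightarrow> L1" is "\<lambda>f g x. f x + g x" by auto

lift_definition minus_L1 :: "L1 \<Rightarrow> L1 \<Rightarrow> L1" is "\<lambda>f g x. f x - g x" by auto

lift_definition uminus_L1 :: "L1 \<Rightarrow> L1" is "\<lambda>f x. - f x" by auto

lift_definition scaleR_L1 :: "real \<Rightarrow> L1 \<Rightarrow> L1" is "\<lambda>c f x. c * f x" by auto

instance
  by standard (transfer; simp add: algebra_simps)+

end

instantiation L1 :: real_normed_vector
begin

lift_definition norm_L1 :: "L1 \<Rightarrow> real" is "\<lambda>f. \<integral>x. \<bar>f x\<bar> \<partial>unit_leb"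
  by (rule integral_cong_AE) (auto simp: borel_measurable_integrable)

definition dist_L1 :: "L1 \<Rightarrow> L1 \<Rightarrow> real"
  where "dist_L1 f g = norm (f - g)"

definition uniformity_L1 :: "(L1 \<times> L1) filter"
  where "uniformity_L1 = (INF e\<in>{0<..}. principal {(f, g). dist f g < e})"

definition open_L1 :: "L1 set \<Rightarrow> bool"
  where "open_L1 U \<longleftrightarrow> (\<forall>f\<in>U. \<forall>\<^sub>F (f', g) in uniformity. f' = f \<longrightarrow> g \<in> U)"

definition sgn_L1 :: "L1 \<Rightarrow> L1"
  where "sgn_L1 f = inverse (norm f) *\<^sub>R f"

instance
proof
  fix f g :: L1 and c :: real and U :: "L1 set"
  show "dist f g = norm (f - g)" by (rule dist_L1_def)
  show "sgn f = inverse (norm f) *\<^sub>R f" by (rule sgn_L1_def)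
  show "uniformity = (INF e\<in>{0<..}. principal {(x, y). dist (x::L1) y < e})"
    by (rule uniformity_L1_def)
  show "open U \<longleftrightarrow> (\<forall>x\<in>U. \<forall>\<^sub>F (x', y) in uniformity. x' = x \<longrightarrow> y \<in> U)"
    by (rule open_L1_def)
  show "norm f = 0 \<longleftrightarrow> f = 0"
    by transfer (subst integral_nonneg_eq_0_iff_AE, auto)
  show "norm (f + g) \<le> norm f + norm g"
  proof transfer
    fix f g :: "real \<Rightarrow> real"
    assume "integrable unit_leb f \<and> integrable unit_leb f \<and> (AE x in unit_leb. f x = f x)"
       and "integrable unit_leb g \<and> integrable unit_leb g \<and> (AE x in unit_leb. g x = g x)"
    then have f: "integrable unit_leb f" and g: "integrable unit_leb g" by auto
    have "(\<integral>x. \<bar>f x + g x\<bar> \<partial>unit_leb) \<le> (\<integral>x. \<bar>f x\<bar> + \<bar>g x\<bar> \<partial>unit_leb)"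
      using f g by (intro integral_mono) auto
    then show "(\<integral>x. \<bar>f x + g x\<bar> \<partial>unit_leb)
        \<le> (\<integral>x. \<bar>f x\<bar> \<partial>unit_leb) + (\<integral>x. \<bar>g x\<bar> \<partial>unit_leb)"
      using f g by simp
  qed
  show "norm (c *\<^sub>R f) = \<bar>c\<bar> * norm f"
    by transfer (simp add: abs_mult)
qed

end

definition schauder_basis :: "(nat \<Rightarrow> 'a::real_normed_vector) \<Rightarrow> bool"
  where "schauder_basis e \<longleftrightarrow> (\<forall>x. \<exists>!a. (\<lambda>n. a n *\<^sub>R e n) sums x)"

definition normalized_schauder_basis :: "(nat \<Rightarrow> 'a::real_normed_vector) \<Rightarrow> bool"
  where "normalized_schauder_basis e \<longleftrightarrow> schauder_basis e \<and> (\<forall>n. norm (e n) = 1)"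

text \<open>The biorthogonal functionals of a Schauder basis are its coordinate functionals;
  this is meaningful only if \<open>e\<close> is a Schauder basis.\<close>

definition biorth :: "(nat \<Rightarrow> 'a::real_normed_vector) \<Rightarrow> nat \<Rightarrow> 'a \<Rightarrow> real"
  where "biorth e n x = (THE a. (\<lambda>k. a k *\<^sub>R e k) sums x) n"

definition identity_factors :: "real \<Rightarrow> ('a::real_normed_vector \<Rightarrow> 'a) \<Rightarrow> bool"
  where "identity_factors K T \<longleftrightarrow>
    (\<exists>R S :: 'a \<Rightarrow> 'a. bounded_linear R \<and> bounded_linear S \<and>
       onorm R * onorm S \<le> K \<and> id = S \<circ> T \<circ> R)"

definition identity_almost_factors :: "real \<Rightarrow> ('a::real_normed_vector \<Rightarrow> 'a) \<Rightarrow> bool"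
  where "identity_almost_factors K T \<longleftrightarrow> (\<forall>\<epsilon>>0. identity_factors (K + \<epsilon>) T)"

text \<open>Only the values of \<open>K\<close> on the positive reals matter. The infimum is that of a
  sequence bounded below by 0, so it is a genuine real infimum.\<close>

definition factorization_property ::
    "(real \<Rightarrow> real) \<Rightarrow> (nat \<Rightarrow> 'a::real_normed_vector) \<Rightarrow> bool"
  where "factorization_property K e \<longleftrightarrow>
    normalized_schauder_basis e \<and>
    (\<forall>\<delta>>0. \<forall>T :: 'a \<Rightarrow> 'a. bounded_linear T \<longrightarrow>
       (INF n. \<bar>biorth e n (T (e n))\<bar>) \<ge> \<delta> \<longrightarrow>
       identity_almost_factors (K \<delta>) T)"

definition dyadic :: "nat \<Rightarrow> nat \<Rightarrow> real set"
  where "dyadic j i = {(real i - 1) / 2 ^ j ..< real i / 2 ^ j}"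

text \<open>For \<open>1 \<le> i \<le> 2 ^ j\<close>, the left and right halves of \<open>dyadic j i\<close> are
  \<open>dyadic (Suc j) (2 * i - 1)\<close> and \<open>dyadic (Suc j) (2 * i)\<close>.\<close>

definition haar_dyadic :: "nat \<Rightarrow> nat \<Rightarrow> real \<Rightarrow> real"
  where "haar_dyadic j i x =
    indicator (dyadic (Suc j) (2 * i - 1)) x - indicator (dyadic (Suc j) (2 * i)) x"

text \<open>The enumeration puts the index \<open>\<emptyset>\<close> at position 0 and \<open>dyadic j i\<close> at position
  \<open>2 ^ j + i - 1\<close>; see lemma \<open>haar_fun_dyadic\<close>.\<close>

definition haar_fun :: "nat \<Rightarrow> real \<Rightarrow> real"
  where "haar_fun n =
    (if n = 0 then indicator {0..<1}
     else haar_dyadic (floor_log n) (n - 2 ^ floor_log n + 1))"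

definition haar :: "nat \<Rightarrow> L1"
  where "haar n = L1_class (haar_fun n)"

definition normalized_haar :: "nat \<Rightarrow> L1"
  where "normalized_haar n = (1 / norm (haar n)) *\<^sub>R haar n"

lemma haar_fun_dyadic:
  assumes "1 \<le> i" "i \<le> 2 ^ j"
  shows "haar_fun (2 ^ j + i - 1) = haar_dyadic j i"
proof -
  have "floor_log (2 ^ j + i - 1) = j"
    using assms by (intro floor_log_eqI) (auto simp: not_le)
  then show ?thesis using assms by (auto simp: haar_fun_def)
qed

lemma dyadic_halves:
  assumes "1 \<le> i"
  shows "dyadic j i = dyadic (Suc j) (2 * i - 1) \<union> dyadic (Suc j) (2 * i)"
    and "dyadic (Suc j) (2 * i - 1) \<inter> dyadic (Suc j) (2 * i) = {}"
  using assms by (auto simp: dyadic_def field_simps of_nat_diff)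

lemma integrable_indicator_atLeastLessThan:
  "integrable unit_leb (indicator {a..<b} :: real \<Rightarrow> real)"
proof -
  have "{0..1} \<inter> {a..<b} \<in> lmeasurable"
    by (intro bounded_set_imp_lmeasurable bounded_Int) auto
  then have "integrable lebesgue (indicator ({0..1} \<inter> {a..<b}) :: real \<Rightarrow> real)"
    by (intro integrable_real_indicator) (auto simp: fmeasurable_def)
  then show ?thesis
    by (subst integrable_restrict_space) (auto simp: indicator_inter_arith[abs_def])
qed

lemma integral_indicator_atLeastLessThan:
  assumes "0 \<le> a" "a \<le> b" "b \<le> 1"
  shows "(\<integral>x. indicator {a..<b} x \<partial>unit_leb) = b - a"
proof -
  have "{0..1} \<inter> {a..<b} = {a..<b}" using assms by auto
  then show ?thesis using assms
    by (subst integral_restrict_space) (auto simp: indicator_inter_arith[symmetric])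
qed

lemma integrable_haar_fun: "integrable unit_leb (haar_fun n)"
  by (cases "n = 0")
    (auto simp: haar_fun_def haar_dyadic_def[abs_def] dyadic_def
      intro!: integrable_indicator_atLeastLessThan)

lemma norm_haar: "norm (haar n) = (if n = 0 then 1 else 1 / 2 ^ floor_log n)"
proof -
  have norm_eq: "norm (haar n) = (\<integral>x. \<bar>haar_fun n x\<bar> \<partial>unit_leb)"
    unfolding haar_def using integrable_haar_fun by (subst norm_L1.abs_eq) (auto simp: eq_onp_def)
  show ?thesis
  proof (cases "n = 0")
    case True
    then show ?thesis
      using integral_indicator_atLeastLessThan[of 0 1]
      unfolding norm_eq by (simp add: haar_fun_def del: Bochner_Integration.integral_indicator)
  next
    case False
    define j i where "j = floor_log n" and "i = n - 2 ^ j + 1"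
    have "2 ^ j \<le> n" "n < 2 * 2 ^ j"
      using False floor_log_exp2_le[of n] floor_log_exp2_gt[of n] by (auto simp: j_def)
    then have i: "1 \<le> i" "i \<le> 2 ^ j" by (auto simp: i_def)
    have le: "real i \<le> 2 ^ j" using i(2) by (metis of_nat_le_iff of_nat_numeral of_nat_power)
    have "n = 2 ^ j + i - 1" using \<open>2 ^ j \<le> n\<close> by (simp add: i_def)
    then have "haar_fun n = haar_dyadic j i" using haar_fun_dyadic[OF i] by simp
    then have "\<bar>haar_fun n x\<bar> = indicator (dyadic j i) x" for x
      using dyadic_halves[OF i(1), of j] by (auto simp: haar_dyadic_def indicator_def)
    then have "norm (haar n) = real i / 2 ^ j - (real i - 1) / 2 ^ j"
      unfolding norm_eq dyadic_def using i(1) le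
      by (simp add: integral_indicator_atLeastLessThan divide_right_mono
          del: Bochner_Integration.integral_indicator)
    then show ?thesis using False by (simp add: j_def diff_divide_distrib)
  qed
qed

end

theory Submission
  imports Defs
begin

text \<open>Number the dyadic intervals as a binary heap: \<open>D 1 = [0,1)\<close>, and \<open>D (2n)\<close> and
  \<open>D (2n+1)\<close> are the left and the right half of \<open>D n\<close>. Then \<open>h_n\<close> is the indicator of \<open>D (2n)\<close>
  minus that of \<open>D (2n+1)\<close>, and for every \<open>N \<ge> 1\<close> the intervals \<open>D m\<close> with \<open>N \<le> m < 2N\<close>
  partition \<open>[0,1)\<close>. The first \<open>N\<close> terms of the Haar expansion of \<open>F\<close> add up to the average of \<open>F\<close>
  over this partition. Averages are contractions and fix dyadic step functions from some point on,
  which are dense; so the Haar functions form a basis.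

  Let now \<open>T\<close> be bounded with \<open>|\<langle>h_n, T h_n\<rangle>| \<ge> \<delta> |D n|\<close>. The idea is to divide out the
  part of \<open>T\<close> that acts as a multiplication, which costs exactly \<open>1 / \<delta>\<close>, and to find a copy of
  \<open>L1\<close> on which the rest is negligible.

  The multiplication part. Let \<open>t_N\<close> be the sum over \<open>N \<le> m < 2N\<close> of the restriction to \<open>D m\<close> of
  \<open>T\<close> applied to the indicator of \<open>D m\<close>. The total mass that \<open>T\<close> moves out of these intervals
  increases with \<open>N\<close>, is at most the norm of \<open>T\<close>, and its increments dominate
  \<open>\<parallel>t_(N+1) - t_N\<parallel>\<close>. Hence \<open>t_N\<close> converges in norm to some \<open>a\<close> (lemma
  \<open>diag_part_LIMSEQ\<close>). The same increments control the difference between \<open>\<langle>h_m, T h_m\<rangle>\<close> and the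
  integral of \<open>t_(2N)\<close> over \<open>D m\<close> for \<open>N \<le> m < 2N\<close>, so
  \<open>|a| \<ge> \<delta>\<close> almost everywhere (lemma \<open>diag_lim_ge\<close>). Multiplication
  by \<open>1 / a\<close> has norm at most \<open>1 / \<delta>\<close> and turns \<open>T\<close> into \<open>I + X\<close>, where the multiplication part
  of \<open>X\<close> is \<open>0\<close>.

  The copy of \<open>L1\<close>. Build a tree of sets \<open>A n\<close>, starting with a short dyadic interval, in which
  \<open>A n\<close> is halved by a function \<open>b_n\<close> with \<open>|b_n|\<close> the indicator of \<open>A n\<close>, namely a signed sum of
  Haar functions \<open>h_m\<close> with \<open>N \<le> m < 2N\<close>. If \<open>N\<close> is large, then for random signs all the numbers
  \<open>\<langle>b_m, X b_n\<rangle>\<close> that involve the new block and earlier ones are tiny: the part of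
  \<open>\<langle>b_n, X b_n\<rangle>\<close> off the diagonal is small in mean square, and its diagonal part is small because
  \<open>X\<close> has no multiplication part (lemma \<open>exists_small_block\<close>). The map \<open>R\<close> that carries \<open>h_n\<close> to
  \<open>b_n / |A 1|\<close> is an isometry, averaging along the tree gives a contraction \<open>S\<close> with \<open>S R = I\<close>,
  and \<open>S X R\<close> has small norm since its Haar matrix has the entries \<open>\<langle>b_m, X b_n\<rangle>\<close> (lemma
  \<open>compression_small\<close>). So \<open>S (I + X) R\<close> is a small perturbation of the identity, and its inverse
  has norm close to \<open>1\<close>.\<close>

section \<open>The Banach space of integrable functions\<close>

lemma integrable_rep_L1 [simp, intro]: "integrable unit_leb (rep_L1 F)"
  using Quotient_rep_reflp[OF Quotient_L1, of F] by auto

lemma borel_measurable_rep_L1 [measurable]: "rep_L1 F \<in> borel_measurable unit_leb"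
  by (intro borel_measurable_integrable integrable_rep_L1)

lemma L1_class_rep_L1 [simp]: "L1_class (rep_L1 F) = F"
  by (rule Quotient_abs_rep[OF Quotient_L1])

lemma AE_rep_L1_class: "integrable unit_leb f \<Longrightarrow> AE x in unit_leb. rep_L1 (L1_class f) x = f x"
  using Quotient_rep_abs[OF Quotient_L1, of f] by auto

lemma L1_class_eqI:
  assumes "integrable unit_leb f" "integrable unit_leb g" "AE x in unit_leb. f x = g x"
  shows "L1_class f = L1_class g"
  using Quotient_rel[OF Quotient_L1, of f g] assms by auto

lemma L1_class_add:
  "integrable unit_leb f \<Longrightarrow> integrable unit_leb g \<Longrightarrow>
    L1_class (\<lambda>x. f x + g x) = L1_class f + L1_class g"
  by (subst plus_L1.abs_eq) (auto simp: eq_onp_def)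

lemma L1_class_diff:
  "integrable unit_leb f \<Longrightarrow> integrable unit_leb g \<Longrightarrow>
    L1_class (\<lambda>x. f x - g x) = L1_class f - L1_class g"
  by (subst minus_L1.abs_eq) (auto simp: eq_onp_def)

lemma L1_class_scale:
  "integrable unit_leb f \<Longrightarrow> L1_class (\<lambda>x. c * f x) = c *\<^sub>R L1_class f"
  by (subst scaleR_L1.abs_eq) (auto simp: eq_onp_def)

lemma L1_class_zero: "L1_class (\<lambda>x. 0) = 0"
  by (simp add: zero_L1_def)

lemma L1_class_sum:
  "(\<And>m. m \<in> M \<Longrightarrow> integrable unit_leb (f m)) \<Longrightarrow>
    L1_class (\<lambda>x. \<Sum>m\<in>M. f m x) = (\<Sum>m\<in>M. L1_class (f m))"
  by (induction M rule: infinite_finite_induct) (auto simp: L1_class_zero L1_class_add)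

lemma norm_L1_class: "integrable unit_leb f \<Longrightarrow> norm (L1_class f) = (\<integral>x. \<bar>f x\<bar> \<partial>unit_leb)"
  by (subst norm_L1.abs_eq) (auto simp: eq_onp_def)

lemma norm_L1_rep: "norm F = (\<integral>x. \<bar>rep_L1 F x\<bar> \<partial>unit_leb)"
  using norm_L1_class[of "rep_L1 F"] by simp

text \<open>A Cauchy sequence has a subsequence that converges almost everywhere, and Fatou's lemma
  turns the Cauchy condition into convergence in norm to the pointwise limit.\<close>

instance L1 :: banach
proof
  fix X :: "nat \<Rightarrow> L1"
  assume X: "Cauchy X"
  define s where "s n = rep_L1 (X n)" for n
  have [measurable]: "s n \<in> borel_measurable unit_leb" and int: "integrable unit_leb (s n)" for n
    by (auto simp: s_def)
  have dist_s: "norm (X i - X j) = (\<integral>x. norm (s i x - s j x) \<partial>unit_leb)" for i j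
    using norm_L1_class[of "\<lambda>x. s i x - s j x"] L1_class_diff[OF int int, of i j] int
    by (simp add: s_def)
  have c: "\<exists>N. \<forall>i\<ge>N. \<forall>j\<ge>N. (LINT x|unit_leb. norm (s i x - s j x)) < e" if "e > 0" for e
    using X that unfolding Cauchy_iff dist_s by blast
  obtain r where r: "strict_mono r" and ae: "AE x in unit_leb. Cauchy (\<lambda>i. s (r i) x)"
    using cauchy_L1_AE_cauchy_subseq[OF int c] by blast
  define u where "u x = lim (\<lambda>i. s (r i) x)" for x
  have [measurable]: "u \<in> borel_measurable unit_leb"
    unfolding u_def by measurable
  have lim_u: "AE x in unit_leb. (\<lambda>i. s (r i) x) \<longlonglongrightarrow> u x"
    using ae by eventually_elim (auto simp: u_def Cauchy_convergent_iff convergent_LIMSEQ_iff)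
  have main: "integrable unit_leb (\<lambda>x. s n x - u x) \<and> (\<integral>x. \<bar>s n x - u x\<bar> \<partial>unit_leb) \<le> e"
    if N: "\<forall>i\<ge>N. \<forall>j\<ge>N. norm (X i - X j) < e" and n: "n \<ge> N" and e: "e > 0" for N n e
  proof -
    have "AE x in unit_leb.
        liminf (\<lambda>i. ennreal \<bar>s n x - s (r i) x\<bar>) = ennreal \<bar>s n x - u x\<bar>"
      using lim_u
    proof eventually_elim
      case (elim x)
      have "(\<lambda>i. ennreal \<bar>s n x - s (r i) x\<bar>) \<longlonglongrightarrow> ennreal \<bar>s n x - u x\<bar>"
        by (intro tendsto_ennrealI tendsto_rabs tendsto_diff tendsto_const elim)
      then show ?case by (intro lim_imp_Liminf) auto
    qed
    then have "(\<integral>\<^sup>+ x. ennreal \<bar>s n x - u x\<bar> \<partial>unit_leb)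
        = (\<integral>\<^sup>+ x. liminf (\<lambda>i. ennreal \<bar>s n x - s (r i) x\<bar>) \<partial>unit_leb)"
      by (intro nn_integral_cong_AE) auto
    also have "\<dots> \<le> liminf (\<lambda>i. \<integral>\<^sup>+ x. ennreal \<bar>s n x - s (r i) x\<bar> \<partial>unit_leb)"
      by (intro nn_integral_liminf) auto
    also have "\<dots> \<le> ennreal e"
    proof (rule Liminf_le)
      have "(\<integral>\<^sup>+ x. ennreal \<bar>s n x - s (r i) x\<bar> \<partial>unit_leb) \<le> ennreal e" if "i \<ge> N" for i
      proof -
        have "r i \<ge> N" using that seq_suble[OF r, of i] by linarith
        then have "norm (X n - X (r i)) < e" using N n by blast
        moreover have "(\<integral>\<^sup>+ x. ennreal \<bar>s n x - s (r i) x\<bar> \<partial>unit_leb) = ennreal (norm (X n - X (r i)))"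
          unfolding dist_s real_norm_def using int
          by (intro nn_integral_eq_integral) auto
        ultimately show ?thesis by (simp add: ennreal_leI)
      qed
      then show "\<forall>\<^sub>F i in sequentially. (\<integral>\<^sup>+ x. ennreal \<bar>s n x - s (r i) x\<bar> \<partial>unit_leb) \<le> ennreal e"
        unfolding eventually_sequentially by blast
    qed auto
    finally have le: "(\<integral>\<^sup>+ x. ennreal \<bar>s n x - u x\<bar> \<partial>unit_leb) \<le> ennreal e" .
    have 1: "integrable unit_leb (\<lambda>x. s n x - u x)"
      by (rule integrableI_bounded) (use le in \<open>auto simp: less_top[symmetric] top_unique\<close>)
    moreover have "ennreal (\<integral>x. \<bar>s n x - u x\<bar> \<partial>unit_leb) \<le> ennreal e"
      using le 1 by (subst nn_integral_eq_integral[symmetric]) auto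
    ultimately show ?thesis using e by (simp add: ennreal_le_iff)
  qed
  have u: "integrable unit_leb u"
  proof -
    obtain N where "\<forall>i\<ge>N. \<forall>j\<ge>N. norm (X i - X j) < 1"
      using X unfolding Cauchy_iff by (metis zero_less_one)
    from main[OF this, of N] have "integrable unit_leb (\<lambda>x. s N x - u x)" by simp
    from Bochner_Integration.integrable_diff[OF int[of N] this] show ?thesis by simp
  qed
  have "X \<longlonglongrightarrow> L1_class u"
  proof (rule LIMSEQ_I)
    fix e :: real assume e: "e > 0"
    obtain N where N: "\<forall>i\<ge>N. \<forall>j\<ge>N. norm (X i - X j) < e / 2"
      using X e unfolding Cauchy_iff by (metis half_gt_zero)
    have "norm (X n - L1_class u) < e" if "n \<ge> N" for n
    proof -
      have "X n - L1_class u = L1_class (\<lambda>x. s n x - u x)"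
        using L1_class_diff[OF int u, of n] by (simp add: s_def)
      then show ?thesis
        using main[OF N that] e by (simp add: norm_L1_class)
    qed
    then show "\<exists>N. \<forall>n\<ge>N. norm (X n - L1_class u) < e" by blast
  qed
  then show "convergent X" by (auto simp: convergent_def)
qed

section \<open>Test functions, pairings and multiplication operators\<close>

text \<open>Integrals against these functions replace the duality with bounded functions. The bound
  holds at every point, so that families with disjoint supports can be compared pointwise.\<close>

definition test_fun :: "(real \<Rightarrow> real) \<Rightarrow> bool"
  where "test_fun g \<longleftrightarrow> g \<in> borel_measurable unit_leb \<and> (\<forall>x. \<bar>g x\<bar> \<le> 1)"

lemma test_measurable [measurable_dest]: "test_fun g \<Longrightarrow> g \<in> borel_measurable unit_leb"
  by (simp add: test_fun_def)

lemma test_indicator: "S \<in> sets unit_leb \<Longrightarrow> test_fun (indicator S)"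
  by (auto simp: test_fun_def indicator_def intro!: borel_measurable_indicator)

lemma integrable_mult_bounded:
  fixes f g :: "real \<Rightarrow> real"
  assumes f: "integrable unit_leb f" and g: "g \<in> borel_measurable unit_leb" "\<And>x. \<bar>g x\<bar> \<le> c"
  shows "integrable unit_leb (\<lambda>x. g x * f x)"
proof (rule Bochner_Integration.integrable_bound)
  show "integrable unit_leb (\<lambda>x. c * f x)" using f by simp
  show "(\<lambda>x. g x * f x) \<in> borel_measurable unit_leb" using f g by measurable
  have "\<bar>g x\<bar> * \<bar>f x\<bar> \<le> \<bar>c\<bar> * \<bar>f x\<bar>" for x
    using g(2)[of x] by (intro mult_right_mono) auto
  then show "AE x in unit_leb. norm (g x * f x) \<le> norm (c * f x)"
    by (simp add: abs_mult)
qed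

definition pair :: "(real \<Rightarrow> real) \<Rightarrow> L1 \<Rightarrow> real"
  where "pair g F = (\<integral>x. g x * rep_L1 F x \<partial>unit_leb)"

definition mulop :: "(real \<Rightarrow> real) \<Rightarrow> L1 \<Rightarrow> L1"
  where "mulop g F = L1_class (\<lambda>x. g x * rep_L1 F x)"

lemma test_integrable: "test_fun g \<Longrightarrow> integrable unit_leb f \<Longrightarrow> integrable unit_leb (\<lambda>x. g x * f x)"
  by (rule integrable_mult_bounded[where c = 1]) (auto simp: test_fun_def)

lemma mulop_class:
  assumes "integrable unit_leb f" "g \<in> borel_measurable unit_leb" "\<And>x. \<bar>g x\<bar> \<le> c"
  shows "mulop g (L1_class f) = L1_class (\<lambda>x. g x * f x)"
  unfolding mulop_def
proof (rule L1_class_eqI)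
  show "integrable unit_leb (\<lambda>x. g x * rep_L1 (L1_class f) x)"
    by (rule integrable_mult_bounded[where c = c]) (use assms in auto)
  show "integrable unit_leb (\<lambda>x. g x * f x)"
    by (rule integrable_mult_bounded[where c = c]) (use assms in auto)
  show "AE x in unit_leb. g x * rep_L1 (L1_class f) x = g x * f x"
    using AE_rep_L1_class[OF assms(1)] by eventually_elim simp
qed

lemma pair_class:
  assumes "integrable unit_leb f" "test_fun g"
  shows "pair g (L1_class f) = (\<integral>x. g x * f x \<partial>unit_leb)"
  unfolding pair_def
proof (rule integral_cong_AE)
  show "AE x in unit_leb. g x * rep_L1 (L1_class f) x = g x * f x"
    using AE_rep_L1_class[OF assms(1)] by eventually_elim simp
qed (use assms in \<open>auto simp: test_fun_def intro!: borel_measurable_times\<close>)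

lemma bounded_linear_mulop:
  assumes g: "g \<in> borel_measurable unit_leb" "\<And>x. \<bar>g x\<bar> \<le> c"
  shows "bounded_linear (mulop g)" and "norm (mulop g F) \<le> c * norm F"
proof -
  have int: "integrable unit_leb (\<lambda>x. g x * rep_L1 F x)" for F
    using g by (intro integrable_mult_bounded[where c = c]) auto
  have norm: "norm (mulop g F) \<le> c * norm F" for F
  proof -
    have "norm (mulop g F) = (\<integral>x. \<bar>g x * rep_L1 F x\<bar> \<partial>unit_leb)"
      unfolding mulop_def using int by (rule norm_L1_class)
    also have "\<dots> \<le> (\<integral>x. c * \<bar>rep_L1 F x\<bar> \<partial>unit_leb)"
      using int g by (intro integral_mono integrable_abs integrable_mult_right)
        (auto simp: abs_mult intro!: mult_right_mono)
    finally show ?thesis by (simp add: norm_L1_rep)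
  qed
  then show "norm (mulop g F) \<le> c * norm F" .
  show "bounded_linear (mulop g)"
  proof (rule bounded_linear_intro[where K = c])
    fix F G :: L1 and r :: real
    have "mulop g (F + G) = mulop g (L1_class (\<lambda>x. rep_L1 F x + rep_L1 G x))"
      by (simp add: L1_class_add)
    also have "\<dots> = L1_class (\<lambda>x. g x * rep_L1 F x + g x * rep_L1 G x)"
      using g by (subst mulop_class[where c = c]) (auto simp: algebra_simps)
    finally show "mulop g (F + G) = mulop g F + mulop g G"
      using int by (simp add: L1_class_add mulop_def)
    have "mulop g (r *\<^sub>R F) = mulop g (L1_class (\<lambda>x. r * rep_L1 F x))"
      by (simp add: L1_class_scale)
    also have "\<dots> = L1_class (\<lambda>x. r * (g x * rep_L1 F x))"
      using g by (subst mulop_class[where c = c]) (auto simp: algebra_simps)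
    finally show "mulop g (r *\<^sub>R F) = r *\<^sub>R mulop g F"
      using int by (simp add: L1_class_scale mulop_def)
    show "norm (mulop g F) \<le> norm F * c" using norm[of F] by (simp add: mult.commute)
  qed
qed

text \<open>Functions with disjoint supports test disjoint parts of \<open>F\<close>. This additivity of the norm is
  what bounds a sum over a whole partition by a single norm throughout.\<close>

lemma pair_sum_le:
  assumes fin: "finite M" and g: "\<And>m. m \<in> M \<Longrightarrow> test_fun (g m)" and le: "\<And>x. (\<Sum>m\<in>M. \<bar>g m x\<bar>) \<le> 1"
  shows "(\<Sum>m\<in>M. \<bar>pair (g m) F\<bar>) \<le> norm F"
proof -
  have int: "integrable unit_leb (\<lambda>x. \<bar>g m x * rep_L1 F x\<bar>)" if "m \<in> M" for m
    using g[OF that] by (intro integrable_abs test_integrable) auto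
  have "(\<Sum>m\<in>M. \<bar>pair (g m) F\<bar>) \<le> (\<Sum>m\<in>M. (\<integral>x. \<bar>g m x * rep_L1 F x\<bar> \<partial>unit_leb))"
    unfolding pair_def by (intro sum_mono integral_abs_bound)
  also have "\<dots> = (\<integral>x. (\<Sum>m\<in>M. \<bar>g m x * rep_L1 F x\<bar>) \<partial>unit_leb)"
    using int by (simp add: Bochner_Integration.integral_sum)
  also have "\<dots> \<le> (\<integral>x. \<bar>rep_L1 F x\<bar> \<partial>unit_leb)"
  proof (rule integral_mono)
    show "integrable unit_leb (\<lambda>x. \<Sum>m\<in>M. \<bar>g m x * rep_L1 F x\<bar>)" using int by auto
    show "(\<Sum>m\<in>M. \<bar>g m x * rep_L1 F x\<bar>) \<le> \<bar>rep_L1 F x\<bar>" for x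
      using mult_right_mono[OF le[of x], of "\<bar>rep_L1 F x\<bar>"]
      by (simp add: abs_mult sum_distrib_right)
  qed auto
  finally show ?thesis by (simp add: norm_L1_rep)
qed

lemma pair_le: "test_fun g \<Longrightarrow> \<bar>pair g F\<bar> \<le> norm F"
  using pair_sum_le[of "{()}" "\<lambda>_. g" F] by (auto simp: test_fun_def)

lemma bounded_linear_pair:
  assumes g: "test_fun g"
  shows "bounded_linear (pair g)"
proof (rule bounded_linear_intro[where K = 1])
  fix F G :: L1 and r :: real
  have int: "integrable unit_leb (\<lambda>x. g x * rep_L1 F x)" for F
    using g by (intro test_integrable) auto
  have "pair g (F + G) = pair g (L1_class (\<lambda>x. rep_L1 F x + rep_L1 G x))"
    by (simp add: L1_class_add)
  also have "\<dots> = (\<integral>x. g x * rep_L1 F x + g x * rep_L1 G x \<partial>unit_leb)"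
    using g by (subst pair_class) (auto simp: algebra_simps)
  finally show "pair g (F + G) = pair g F + pair g G"
    using int by (simp add: pair_def)
  have "pair g (r *\<^sub>R F) = pair g (L1_class (\<lambda>x. r * rep_L1 F x))"
    by (simp add: L1_class_scale)
  also have "\<dots> = (\<integral>x. r * (g x * rep_L1 F x) \<partial>unit_leb)"
    using g by (subst pair_class) (auto simp: algebra_simps)
  finally show "pair g (r *\<^sub>R F) = r *\<^sub>R pair g F" by (simp add: pair_def)
  show "norm (pair g F) \<le> norm F * 1" using pair_le[OF g] by simp
qed

lemma pair_mulop:
  assumes "test_fun g" "test_fun h"
  shows "pair g (mulop h F) = pair (\<lambda>x. g x * h x) F"
  unfolding mulop_def using assms
  by (subst pair_class) (auto simp: test_integrable pair_def mult.assoc)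

lemma pair_add: "test_fun g \<Longrightarrow> test_fun h \<Longrightarrow> pair (\<lambda>x. g x + h x) F = pair g F + pair h F"
  unfolding pair_def distrib_right by (intro Bochner_Integration.integral_add test_integrable) auto

lemma pair_diff: "test_fun g \<Longrightarrow> test_fun h \<Longrightarrow> pair (\<lambda>x. g x - h x) F = pair g F - pair h F"
  unfolding pair_def left_diff_distrib
  by (intro Bochner_Integration.integral_diff test_integrable) auto

lemma pair_sum: 
  "(\<And>m. m \<in> M \<Longrightarrow> test_fun (g m)) \<Longrightarrow> pair (\<lambda>x. \<Sum>m\<in>M. c m * g m x) F = (\<Sum>m\<in>M. c m * pair (g m) F)"
  unfolding pair_def sum_distrib_right mult.assoc
  by (subst Bochner_Integration.integral_sum) (auto simp: test_integrable)

lemma mulop_sum_le: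
  assumes fin: "finite M" and g: "\<And>m. m \<in> M \<Longrightarrow> test_fun (g m)" and le: "\<And>x. (\<Sum>m\<in>M. \<bar>g m x\<bar>) \<le> 1"
  shows "(\<Sum>m\<in>M. norm (mulop (g m) F)) \<le> norm F"
proof -
  have int: "integrable unit_leb (\<lambda>x. g m x * rep_L1 F x)" if "m \<in> M" for m
    using g[OF that] by (intro test_integrable) auto
  then have int': "integrable unit_leb (\<lambda>x. \<bar>g m x * rep_L1 F x\<bar>)" if "m \<in> M" for m
    using that by auto
  have "(\<Sum>m\<in>M. norm (mulop (g m) F)) = (\<Sum>m\<in>M. (\<integral>x. \<bar>g m x * rep_L1 F x\<bar> \<partial>unit_leb))"
    unfolding mulop_def using int by (intro sum.cong refl norm_L1_class)
  also have "\<dots> = (\<integral>x. (\<Sum>m\<in>M. \<bar>g m x * rep_L1 F x\<bar>) \<partial>unit_leb)"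
    using int' by (simp add: Bochner_Integration.integral_sum)
  also have "\<dots> \<le> (\<integral>x. \<bar>rep_L1 F x\<bar> \<partial>unit_leb)"
  proof (rule integral_mono)
    show "integrable unit_leb (\<lambda>x. \<Sum>m\<in>M. \<bar>g m x * rep_L1 F x\<bar>)" using int' by auto
    show "(\<Sum>m\<in>M. \<bar>g m x * rep_L1 F x\<bar>) \<le> \<bar>rep_L1 F x\<bar>" for x
      using mult_right_mono[OF le[of x], of "\<bar>rep_L1 F x\<bar>"]
      by (simp add: abs_mult sum_distrib_right)
  qed auto
  finally show ?thesis by (simp add: norm_L1_rep)
qed

definition ind :: "real set \<Rightarrow> L1"
  where "ind S = L1_class (indicator S)"

lemma sets_unit_lebD: "S \<in> sets unit_leb \<Longrightarrow> S \<inter> {0..1} = S"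
  using sets.sets_into_space[of S unit_leb] by auto

lemma finite_measure_unit_leb: "finite_measure unit_leb"
  by (auto intro: finite_measure_lebesgue_on)

lemma integrable_indicator_unit:
  "S \<in> sets unit_leb \<Longrightarrow> integrable unit_leb (indicator S :: real \<Rightarrow> real)"
  using finite_measure.emeasure_finite[OF finite_measure_unit_leb]
  by (intro integrable_real_indicator) (auto simp: less_top)

lemma norm_ind: "S \<in> sets unit_leb \<Longrightarrow> norm (ind S) = measure unit_leb S"
  unfolding ind_def by (subst norm_L1_class) (auto simp: integrable_indicator_unit sets_unit_lebD)

lemma pair_ind:
  "S \<in> sets unit_leb \<Longrightarrow> S' \<in> sets unit_leb \<Longrightarrow>
    pair (indicator S) (ind S') = measure unit_leb (S \<inter> S')"
  unfolding ind_def
  by (subst pair_class) (auto simp: integrable_indicator_unit test_indicator sets_unit_lebD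
      indicator_inter_arith[symmetric] Int_assoc)

lemma ind_eq_sum:
  assumes "\<And>m. m \<in> M \<Longrightarrow> S m \<in> sets unit_leb" "\<And>x. indicator S' x = (\<Sum>m\<in>M. indicator (S m) x :: real)"
  shows "ind S' = (\<Sum>m\<in>M. ind (S m))"
  unfolding ind_def using assms(1) 
  by (subst L1_class_sum[symmetric]) (auto simp: integrable_indicator_unit assms(2)[abs_def])

section \<open>Halving trees and the dyadic intervals\<close>

text \<open>The nodes \<open>N, ..., 2N - 1\<close> of a heap meet every branch exactly once. Increasing \<open>N\<close> by one
  replaces the node \<open>N\<close> by its two children, so statements about such a section of the tree are
  proved by induction on \<open>N\<close>, one split at a time.\<close>

lemma heap_level_step:
  fixes f :: "nat \<Rightarrow> 'a::ab_group_add"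
  assumes "N \<ge> 1"
  shows "(\<Sum>m\<in>{Suc N..<2 * Suc N}. f m) = (\<Sum>m\<in>{N..<2 * N}. f m) - f N + f (2 * N) + f (2 * N + 1)"
proof -
  have "{N..<2 * N} = insert N {Suc N..<2 * N}" using assms by auto
  moreover have "{Suc N..<2 * Suc N} = insert (2 * N + 1) (insert (2 * N) {Suc N..<2 * N})"
    using assms by auto
  ultimately show ?thesis by (simp add: algebra_simps)
qed

text \<open>Node \<open>n \<ge> 1\<close> of a heap has depth \<open>floor_log n\<close>; this is its share of the mass of the root. The
  value 1 at index 0 belongs to the constant function.\<close>

definition weight :: "nat \<Rightarrow> real"
  where "weight n = 1 / 2 ^ floor_log n"

lemma weight_0 [simp]: "weight 0 = 1"
  and weight_1 [simp]: "weight (Suc 0) = 1"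
  by (auto simp: weight_def)

lemma floor_log_twice_plus1: "n \<noteq> 0 \<Longrightarrow> floor_log (2 * n + 1) = Suc (floor_log n)"
  by (subst floor_log_rec) auto

lemma weight_children [simp]:
  assumes "n \<noteq> 0"
  shows "weight (2 * n) = weight n / 2" "weight (Suc (2 * n)) = weight n / 2"
  using floor_log_twice_plus1[OF assms] assms by (auto simp: weight_def)

lemma weight_pos [simp]: "weight n > 0"
  by (simp add: weight_def)

lemma weight_nonzero [simp]: "weight n \<noteq> 0"
  using weight_pos[of n] by linarith

lemma abs_weight [simp]: "\<bar>weight n\<bar> = weight n"
  using weight_pos[of n] by linarith

lemma weight_le: "n \<ge> 1 \<Longrightarrow> weight n \<le> 2 / n"
proof -
  assume n: "n \<ge> 1"
  have "real n < real (2 * 2 ^ floor_log n)" using floor_log_exp2_gt[of n] of_nat_less_iff by blast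
  then show ?thesis using n by (simp add: weight_def field_simps)
qed

lemma weight_ge: "weight n \<ge> 1 / 2 ^ n"
proof -
  have "floor_log n \<le> n"
    by (metis floor_log_exp2_le floor_log_zero le0 le_trans less_exp less_imp_le not_gr_zero)
  then show ?thesis by (simp add: weight_def field_simps)
qed

text \<open>A copy of the system of dyadic intervals inside \<open>[0,1]\<close>, with nodes numbered from 1. It is
  used for the dyadic intervals and for the tree of sets that supports the blocks.\<close>

locale halving_tree =
  fixes A :: "nat \<Rightarrow> real set"
  assumes sets_tree: "n \<ge> 1 \<Longrightarrow> A n \<in> sets unit_leb"
    and split: "n \<ge> 1 \<Longrightarrow> A n = A (2 * n) \<union> A (2 * n + 1)"
    and disjoint: "n \<ge> 1 \<Longrightarrow> A (2 * n) \<inter> A (2 * n + 1) = {}"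
    and halves: "n \<ge> 1 \<Longrightarrow> measure unit_leb (A (2 * n)) = measure unit_leb (A (2 * n + 1))"
    and root_pos: "measure unit_leb (A 1) > 0"
begin

abbreviation "mass \<equiv> measure unit_leb (A 1)"

lemma measure_children:
  assumes "n \<ge> 1"
  shows "measure unit_leb (A (2 * n)) = measure unit_leb (A n) / 2"
    and "measure unit_leb (A (2 * n + 1)) = measure unit_leb (A n) / 2"
proof -
  have "measure unit_leb (A n) = measure unit_leb (A (2 * n)) + measure unit_leb (A (2 * n + 1))"
    unfolding split[OF assms]
    using assms sets_tree[of "2 * n"] sets_tree[of "2 * n + 1"]
    by (intro finite_measure.finite_measure_Union[OF finite_measure_unit_leb] disjoint) auto
  then show "measure unit_leb (A (2 * n)) = measure unit_leb (A n) / 2"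
    and "measure unit_leb (A (2 * n + 1)) = measure unit_leb (A n) / 2"
    using halves[OF assms] by auto
qed

lemma measure_tree: "n \<ge> 1 \<Longrightarrow> measure unit_leb (A n) = mass * weight n"
proof (induction n rule: less_induct)
  case (less n)
  show ?case
  proof (cases "n = 1")
    case False
    then have "n div 2 \<ge> 1" "n div 2 < n" using less.prems by auto
    with less.IH[of "n div 2"] have IH: "measure unit_leb (A (n div 2)) = mass * weight (n div 2)"
      by auto
    define k where "k = n div 2"
    have k: "k \<ge> 1" "measure unit_leb (A k) = mass * weight k"
      using IH \<open>n div 2 \<ge> 1\<close> by (auto simp: k_def)
    consider "n = 2 * k" | "n = 2 * k + 1" unfolding k_def by linarith
    then show ?thesis
      using measure_children[OF k(1)] weight_children[of k] k by cases auto
  qed auto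
qed

lemma indicator_children:
  "n \<ge> 1 \<Longrightarrow> (indicator (A n) x :: real) = indicator (A (2 * n)) x + indicator (A (2 * n + 1)) x"
  using split[of n] disjoint[of n] by (auto simp: indicator_def)

lemma indicator_level:
  "N \<ge> 1 \<Longrightarrow> (\<Sum>m\<in>{N..<2 * N}. indicator (A m) x) = (indicator (A 1) x :: real)"
proof (induction N rule: nat_induct_at_least)
  case base
  then show ?case by (simp add: numeral_2_eq_2)
next
  case (Suc N)
  then show ?case
    using heap_level_step[of N "\<lambda>m. indicator (A m) x :: real"] indicator_children[of N x] by simp
qed

lemma disjoint_level:
  assumes "m \<in> {N..<2 * N}" "k \<in> {N..<2 * N}" "m \<noteq> k"
  shows "A m \<inter> A k = {}"
proof (rule ccontr)
  assume "A m \<inter> A k \<noteq> {}"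
  then obtain x where x: "x \<in> A m" "x \<in> A k" by auto
  have N: "N \<ge> 1" using assms by auto
  have "2 = (\<Sum>i\<in>{m, k}. indicator (A i) x :: real)" using x assms by simp
  also have "\<dots> \<le> (\<Sum>i\<in>{N..<2 * N}. indicator (A i) x)"
    using assms by (intro sum_mono2) auto
  also have "\<dots> \<le> 1" unfolding indicator_level[OF N] by (simp add: indicator_def)
  finally show False by simp
qed

lemma nested: "1 \<le> j \<Longrightarrow> j \<le> m \<Longrightarrow> A m \<subseteq> A j \<or> A m \<inter> A j = {}"
proof (induction m rule: less_induct)
  case (less m)
  show ?case
  proof (cases "j \<le> m div 2")
    case True
    then have m: "m div 2 \<ge> 1" "m div 2 < m" using less.prems by auto
    have "m = 2 * (m div 2) \<or> m = 2 * (m div 2) + 1" by auto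
    then have "A m \<subseteq> A (m div 2)" using split[OF m(1)] by (metis Un_upper1 Un_upper2)
    with less.IH[OF m(2) less.prems(1) True] show ?thesis by blast
  next
    case False
    then have "m \<in> {j..<2 * j}" "j \<in> {j..<2 * j}" using less.prems by auto
    with disjoint_level[of m j j] show ?thesis by blast
  qed
qed

definition haar_of :: "nat \<Rightarrow> real \<Rightarrow> real"
  where "haar_of n x = (if n = 0 then indicator (A 1) x
     else indicator (A (2 * n)) x - indicator (A (2 * n + 1)) x)"

lemma abs_haar_of: "\<bar>haar_of n x\<bar> = indicator (A (if n = 0 then 1 else n)) x"
  using split[of n] disjoint[of n] by (auto simp: haar_of_def indicator_def)

lemma test_haar_of: "test_fun (haar_of n)"
proof -
  have "haar_of n \<in> borel_measurable unit_leb"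
    unfolding haar_of_def[abs_def]
    by (cases "n = 0") (auto intro!: borel_measurable_diff borel_measurable_indicator sets_tree)
  then show ?thesis by (auto simp: test_fun_def abs_haar_of indicator_def)
qed

lemma integrable_haar_of: "integrable unit_leb (haar_of n)"
  unfolding haar_of_def[abs_def]
  by (cases "n = 0")
    (auto intro!: Bochner_Integration.integrable_diff integrable_indicator_unit sets_tree)

lemma pair_haar_of:
  "n \<ge> 1 \<Longrightarrow> pair (haar_of n) F = pair (indicator (A (2 * n))) F - pair (indicator (A (2 * n + 1))) F"
  unfolding haar_of_def[abs_def]
  by (subst pair_diff[symmetric]) (auto intro!: test_indicator sets_tree)

lemma class_haar_of:
  "n \<ge> 1 \<Longrightarrow> L1_class (haar_of n) = ind (A (2 * n)) - ind (A (2 * n + 1))"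
  unfolding haar_of_def[abs_def] ind_def
  by (subst L1_class_diff[symmetric]) (auto intro!: integrable_indicator_unit sets_tree)

lemma norm_haar_of: "norm (L1_class (haar_of n)) = mass * weight n"
  using norm_ind[of "A n"] norm_ind[of "A 1"] measure_tree[of n] sets_tree[of n] sets_tree[of 1]
  by (subst norm_L1_class)
    (auto simp: integrable_haar_of abs_haar_of ind_def norm_L1_class integrable_indicator_unit)

text \<open>A node numbered below the children of \<open>m\<close> either contains \<open>A m\<close> or misses it, so the two halves
  of the Haar function cancel on it. Orthogonality is a consequence.\<close>

lemma pair_haar_of_tree:
  assumes "1 \<le> j" "j < 2 * m"
  shows "pair (haar_of m) (ind (A j)) = 0"
proof -
  have m: "m \<ge> 1" using assms by auto
  have eq: "pair (haar_of m) (ind (A j)) =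
      measure unit_leb (A (2 * m) \<inter> A j) - measure unit_leb (A (2 * m + 1) \<inter> A j)"
    using assms m by (simp add: pair_haar_of pair_ind sets_tree)
  have "A m \<subseteq> A j \<or> A m \<inter> A j = {}"
  proof (cases "j \<le> m")
    case True
    then show ?thesis using nested assms by blast
  next
    case False
    then show ?thesis using disjoint_level[of m m j] assms by auto
  qed
  then show ?thesis
  proof
    assume "A m \<subseteq> A j"
    then have "A (2 * m) \<inter> A j = A (2 * m)" "A (2 * m + 1) \<inter> A j = A (2 * m + 1)"
      using split[OF m] by auto
    then show ?thesis using eq halves[OF m] by simp
  next
    assume "A m \<inter> A j = {}"
    then have "A (2 * m) \<inter> A j = {}" "A (2 * m + 1) \<inter> A j = {}" using split[OF m] by auto
    then show ?thesis using eq by simp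
  qed
qed

lemma pair_haar_of_commute:
  "pair (haar_of m) (L1_class (haar_of n)) = pair (haar_of n) (L1_class (haar_of m))"
  by (simp add: pair_class integrable_haar_of test_haar_of mult.commute)

lemma haar_of_orthogonal:
  "pair (haar_of m) (L1_class (haar_of n)) = (if m = n then mass * weight n else 0)"
proof -
  have lt: "pair (haar_of m) (L1_class (haar_of n)) = 0" if "n < m" for m n
  proof (cases "n = 0")
    case True
    then have "L1_class (haar_of n) = ind (A 1)" by (simp add: haar_of_def[abs_def] ind_def)
    then show ?thesis using pair_haar_of_tree[of 1 m] that by simp
  next
    case False
    then show ?thesis
      using class_haar_of[of n] pair_haar_of_tree[of "2 * n" m] pair_haar_of_tree[of "2 * n + 1" m] that
        linear_diff[OF bounded_linear.linear[OF bounded_linear_pair[OF test_haar_of]]]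
      by simp
  qed
  have eq: "pair (haar_of n) (L1_class (haar_of n)) = mass * weight n" for n
  proof -
    have "pair (haar_of n) (L1_class (haar_of n)) = (\<integral>x. \<bar>haar_of n x\<bar> \<partial>unit_leb)"
      by (subst pair_class)
        (auto simp: integrable_haar_of test_haar_of haar_of_def indicator_def disjoint
          intro!: Bochner_Integration.integral_cong dest: disjoint)
    then show ?thesis using norm_haar_of[of n] by (simp add: norm_L1_class integrable_haar_of)
  qed
  show ?thesis
    using lt[of n m] lt[of m n] eq[of n] pair_haar_of_commute[of m n]
    by (cases m n rule: linorder_cases) auto
qed

lemma pair_level_le: "N \<ge> 1 \<Longrightarrow> (\<Sum>m\<in>{N..<2 * N}. \<bar>pair (indicator (A m)) F\<bar>) \<le> norm F"
  by (intro pair_sum_le) (auto simp: test_indicator sets_tree indicator_level intro: indicator_le_1)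

end

definition dyad :: "nat \<Rightarrow> real set"
  where "dyad n = dyadic (floor_log n) (n - 2 ^ floor_log n + 1)"

text \<open>The offset \<open>- 1\<close> appears because the nodes of depth \<open>j\<close> are numbered from \<open>2 ^ j\<close>.\<close>

lemma dyad_eq:
  assumes "n \<ge> 1"
  shows "dyad n = {real n * weight n - 1 ..< (real n + 1) * weight n - 1}"
proof -
  have "2 ^ floor_log n \<le> n" using assms floor_log_exp2_le by simp
  then have "real (n - 2 ^ floor_log n) = real n - 2 ^ floor_log n"
    by (simp add: of_nat_diff)
  then have "(real (n - 2 ^ floor_log n + 1) - 1) / 2 ^ floor_log n = real n * weight n - 1"
      and "real (n - 2 ^ floor_log n + 1) / 2 ^ floor_log n = (real n + 1) * weight n - 1"
    by (simp_all add: weight_def diff_divide_distrib add_divide_distrib)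
  then show ?thesis by (simp only: dyad_def dyadic_def)
qed

lemma dyad_1: "dyad (Suc 0) = {0..<1}"
  by (auto simp: dyad_def dyadic_def)

lemma dyad_split:
  assumes "n \<ge> 1"
  shows "dyad n = dyad (2 * n) \<union> dyad (2 * n + 1)" "dyad (2 * n) \<inter> dyad (2 * n + 1) = {}"
proof -
  have 1: "dyad (2 * n) = {real n * weight n - 1 ..< (real n + 1/2) * weight n - 1}"
    using assms dyad_eq[of "2 * n"] by (simp add: distrib_right add_divide_distrib)
  have 2: "dyad (2 * n + 1) = {(real n + 1/2) * weight n - 1 ..< (real n + 1) * weight n - 1}"
    using assms dyad_eq[of "2 * n + 1"] by (simp add: distrib_right add_divide_distrib add.commute)
  have "weight n > 0" by simp
  then show "dyad n = dyad (2 * n) \<union> dyad (2 * n + 1)"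
    unfolding 1 2 dyad_eq[OF assms] by (intro ivl_disj_un_two(3)[symmetric]) auto
  show "dyad (2 * n) \<inter> dyad (2 * n + 1) = {}"
    unfolding 1 2 by auto
qed

lemma dyad_bounds:
  assumes "n \<ge> 1"
  shows "0 \<le> real n * weight n - 1" "(real n + 1) * weight n - 1 \<le> 1"
proof -
  have 1: "2 ^ floor_log n \<le> n" using assms floor_log_exp2_le by simp
  have "n + 1 \<le> 2 * 2 ^ floor_log n" using floor_log_exp2_gt[of n] by linarith
  then have "real (n + 1) \<le> real (2 * 2 ^ floor_log n)" using of_nat_le_iff by blast
  then show "(real n + 1) * weight n - 1 \<le> 1" by (simp add: weight_def field_simps)
  have "real (2 ^ floor_log n) \<le> real n" using 1 of_nat_le_iff by blast
  then show "0 \<le> real n * weight n - 1" by (simp add: weight_def field_simps)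
qed

lemma measure_dyad: "n \<ge> 1 \<Longrightarrow> measure unit_leb (dyad n) = weight n"
proof -
  assume n: "n \<ge> 1"
  let ?a = "real n * weight n - 1" and ?b = "(real n + 1) * weight n - 1"
  have "measure unit_leb (dyad n) = (\<integral>x. indicator (dyad n) x \<partial>unit_leb)"
    using dyad_bounds[OF n]
    by (auto simp: dyad_eq[OF n] intro!: arg_cong[where f = "measure unit_leb"])
  also have "\<dots> = ?b - ?a"
    unfolding dyad_eq[OF n] using dyad_bounds[OF n]
    by (intro integral_indicator_atLeastLessThan) auto
  finally show ?thesis by (simp add: algebra_simps)
qed

interpretation dyad: halving_tree dyad
  rewrites "measure unit_leb (dyad 1) = 1"
proof -
  show "halving_tree dyad"
  proof
    fix n :: nat assume n: "n \<ge> 1"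
    show "dyad n \<in> sets unit_leb"
      using dyad_bounds[OF n] by (auto simp: dyad_eq[OF n] sets_restrict_space_iff)
    show "dyad n = dyad (2 * n) \<union> dyad (2 * n + 1)" "dyad (2 * n) \<inter> dyad (2 * n + 1) = {}"
      using dyad_split[OF n] by auto
    show "measure unit_leb (dyad (2 * n)) = measure unit_leb (dyad (2 * n + 1))"
      using n by (simp add: measure_dyad)
  qed (simp add: measure_dyad)
  show "measure unit_leb (dyad 1) = 1" by (simp add: measure_dyad)
qed

lemma haar_fun_eq: "haar_fun n = dyad.haar_of n"
proof (cases "n = 0")
  case True
  then show ?thesis by (auto simp: haar_fun_def dyad.haar_of_def dyad_1)
next
  case False
  have le: "2 ^ floor_log n \<le> n" using False floor_log_exp2_le by simp
  have 1: "dyad (2 * n) = dyadic (Suc (floor_log n)) (2 * (n - 2 ^ floor_log n + 1) - 1)"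
    using False le by (auto simp: dyad_def intro!: arg_cong[where f = "dyadic _"])
  have 2: "dyad (2 * n + 1) = dyadic (Suc (floor_log n)) (2 * (n - 2 ^ floor_log n + 1))"
    unfolding dyad_def floor_log_twice_plus1[OF False]
    using le by (intro arg_cong[where f = "dyadic _"]) auto
  show ?thesis using False
    by (auto simp: haar_fun_def dyad.haar_of_def haar_dyadic_def 1 2[simplified])
qed

lemma haar_eq: "haar n = L1_class (dyad.haar_of n)"
  by (simp add: haar_def haar_fun_eq)

lemma norm_haar_weight: "norm (haar n) = weight n"
  by (simp add: norm_haar weight_def)

section \<open>Density of dyadic step functions\<close>

lemma L1_class_tendsto:
  assumes s: "\<And>i. integrable unit_leb (s i)" and f: "integrable unit_leb f"
    and lim: "AE x in unit_leb. (\<lambda>i. s i x) \<longlonglongrightarrow> f x"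
    and le: "\<And>i x. x \<in> {0..1} \<Longrightarrow> \<bar>s i x\<bar> \<le> g x" and g: "integrable unit_leb g"
  shows "(\<lambda>i. L1_class (s i)) \<longlonglongrightarrow> L1_class f"
proof -
  have "(\<lambda>i. \<integral>x. \<bar>s i x - f x\<bar> \<partial>unit_leb) \<longlonglongrightarrow> (\<integral>x. 0 \<partial>unit_leb)"
  proof (rule integral_dominated_convergence)
    show "integrable unit_leb (\<lambda>x. g x + \<bar>f x\<bar>)" using g f by auto
    show "AE x in unit_leb. (\<lambda>i. \<bar>s i x - f x\<bar>) \<longlonglongrightarrow> 0"
      using lim
    proof eventually_elim
      case (elim x)
      from tendsto_rabs[OF tendsto_diff[OF elim tendsto_const[of "f x"]]] show ?case by simp
    qed
    show "AE x in unit_leb. norm \<bar>s i x - f x\<bar> \<le> g x + \<bar>f x\<bar>" for i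
    proof (rule AE_I2)
      fix x assume "x \<in> space unit_leb"
      then show "norm \<bar>s i x - f x\<bar> \<le> g x + \<bar>f x\<bar>" using le[of x i] by (auto simp: space_restrict_space)
    qed
  qed (use s f in \<open>auto intro!: borel_measurable_integrable\<close>)
  then have "(\<lambda>i. norm (L1_class (s i) - L1_class f)) \<longlonglongrightarrow> 0"
    using s f by (simp add: L1_class_diff[symmetric] norm_L1_class)
  then show ?thesis using LIM_zero_iff tendsto_norm_zero_iff by blast
qed

lemma dyad_small:
  assumes "x \<in> dyad m" "y \<in> dyad m" "m \<ge> N" "N \<ge> 1"
  shows "\<bar>x - y\<bar> < 2 / N"
proof -
  have m: "m \<ge> 1" using assms by simp
  have "\<bar>x - y\<bar> < weight m"
    using assms unfolding dyad_eq[OF m] by (auto simp: algebra_simps)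
  also have "\<dots> \<le> 2 / m" using m by (rule weight_le)
  also have "\<dots> \<le> 2 / N" using assms by (intro divide_left_mono) auto
  finally show ?thesis .
qed

text \<open>Density of the dyadic step functions. The dyadic intervals \<open>D m\<close> with \<open>N \<le> m < 2N\<close> inside an
  open set exhaust it (up to the point 1) as \<open>N\<close> grows, because their lengths tend to 0, and open
  sets approximate measurable sets from outside.\<close>

lemma subspace_dyad_UNIV:
  assumes S: "subspace S" "closed S" and dyad: "\<And>j. j \<ge> 1 \<Longrightarrow> ind (dyad j) \<in> S"
  shows "F \<in> S"
proof -
  have open_S: "ind (U \<inter> {0..1}) \<in> S" if U: "open U" for U
  proof -
    define M where "M N = {m \<in> {N..<2 * N}. dyad m \<subseteq> U}" for N
    define s where "s N x = (\<Sum>m\<in>M (Suc N). indicator (dyad m) x :: real)" for N x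
    have s_le: "s N x \<le> 1" for N x
    proof -
      have "s N x \<le> (\<Sum>m\<in>{Suc N..<2 * Suc N}. indicator (dyad m) x)"
        unfolding s_def M_def by (intro sum_mono2) auto
      also have "\<dots> \<le> 1" by (subst dyad.indicator_level) (auto simp: indicator_def)
      finally show ?thesis .
    qed
    have int_s: "integrable unit_leb (s N)" for N
      unfolding s_def[abs_def] M_def
      by (auto intro!: Bochner_Integration.integrable_sum integrable_indicator_unit dyad.sets_tree)
    have "(\<lambda>N. L1_class (s N)) \<longlonglongrightarrow> ind (U \<inter> {0..1})"
      unfolding ind_def
    proof (rule L1_class_tendsto[where g = "\<lambda>_. 1"])
      show "integrable unit_leb (indicator (U \<inter> {0..1}) :: real \<Rightarrow> real)"
        using U by (intro integrable_indicator_unit) (auto simp: sets_restrict_space_iff)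
      show "\<bar>s N x\<bar> \<le> 1" for N x using s_le[of N x] by (auto simp: s_def sum_nonneg abs_of_nonneg)
      have "{1::real} \<in> null_sets unit_leb"
        by (auto simp: null_sets_restrict_space)
      then have "AE x in unit_leb. x \<noteq> 1" using AE_not_in[of "{1}" unit_leb] by simp
      then show "AE x in unit_leb. (\<lambda>N. s N x) \<longlonglongrightarrow> indicator (U \<inter> {0..1}) x"
      proof (rule AE_mp[OF _ AE_I2], intro impI)
        fix x assume "x \<in> space unit_leb" "x \<noteq> (1::real)"
        then have x: "0 \<le> x" "x < 1" by (auto simp: space_restrict_space)
        show "(\<lambda>N. s N x) \<longlonglongrightarrow> indicator (U \<inter> {0..1}) x"
        proof (cases "x \<in> U")
          case False
          then have "s N x = 0" for N by (auto simp: s_def M_def indicator_def intro!: sum.neutral)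
          then show ?thesis using False by simp
        next
          case True
          obtain r where r: "r > 0" "\<And>y. \<bar>x - y\<bar> < r \<Longrightarrow> y \<in> U"
            using U True unfolding open_dist by (auto simp: dist_real_def abs_minus_commute)
          have "s N x = 1" if N: "real N \<ge> 2 / r" for N
          proof -
            have "2 / real (Suc N) \<le> r" using N r by (simp add: field_simps)
            then have "dyad m \<subseteq> U" if "m \<in> {Suc N..<2 * Suc N}" "x \<in> dyad m" for m
              using dyad_small[OF that(2), of _ "Suc N"] that(1) r(2) by force
            then have "s N x = (\<Sum>m\<in>{Suc N..<2 * Suc N}. indicator (dyad m) x)"
              unfolding s_def M_def by (intro sum.mono_neutral_left) (auto simp: indicator_def subset_iff)
            also have "\<dots> = 1" using x by (subst dyad.indicator_level) (auto simp: dyad_1)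
            finally show ?thesis .
          qed
          then have "eventually (\<lambda>N. s N x = 1) sequentially"
            by (intro eventually_sequentiallyI[of "nat \<lceil>2 / r\<rceil>"]) (simp add: le_nat_iff ceiling_le_iff nat_le_iff)
          then show ?thesis using True x by (simp add: tendsto_eventually)
        qed
      qed
    qed (use int_s finite_measure_unit_leb in \<open>auto simp: finite_measure.integrable_const\<close>)
    moreover have "L1_class (s N) \<in> S" for N
      unfolding s_def[abs_def]
      by (subst L1_class_sum)
        (auto simp: M_def ind_def[symmetric] intro!: subspace_sum[OF S(1)] dyad
          integrable_indicator_unit dyad.sets_tree)
    ultimately show ?thesis
      using closed_sequentially[OF S(2), of "\<lambda>N. L1_class (s N)"] by blast
  qed
  have set_S: "ind A \<in> S" if A: "A \<in> sets unit_leb" for A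
  proof -
    have "\<exists>y\<in>S. dist y (ind A) < e" if e: "e > 0" for e
    proof -
      have "A \<in> sets lebesgue" using A by (auto simp: sets_restrict_space_iff)
      from sets_lebesgue_outer_open[OF this e] obtain U where
        U: "open U" "A \<subseteq> U" "U - A \<in> lmeasurable" "emeasure lebesgue (U - A) < ennreal e" .
      have U': "U \<inter> {0..1} \<in> sets unit_leb" using U by (auto simp: sets_restrict_space_iff)
      have A01: "A \<subseteq> {0..1}" using sets_unit_lebD[OF A] by auto
      have D: "U \<inter> {0..1} - A \<in> sets unit_leb" using U' A by auto
      have "ind (U \<inter> {0..1}) - ind A = ind (U \<inter> {0..1} - A)"
        unfolding ind_def using U' A U(2) A01
        by (subst L1_class_diff[symmetric])
          (auto simp: integrable_indicator_unit indicator_def fun_eq_iff subset_iff intro!: arg_cong[where f = L1_class])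
      then have "dist (ind (U \<inter> {0..1})) (ind A) = measure unit_leb (U \<inter> {0..1} - A)"
        using norm_ind[OF D] by (simp add: dist_norm)
      also have "\<dots> = measure lebesgue (U \<inter> {0..1} - A)"
        by (intro measure_restrict_space) auto
      also have "\<dots> \<le> measure lebesgue (U - A)"
        using U D by (intro measure_mono_fmeasurable) (auto simp: sets_restrict_space_iff)
      also have "\<dots> < e" using U e by (simp add: emeasure_eq_measure2 ennreal_less_iff)
      finally show ?thesis using open_S[OF U(1)] by blast
    qed
    then show ?thesis using closed_approachable[OF S(2)] by blast
  qed
  have "L1_class f \<in> S" if "integrable unit_leb f" for f
    using that
  proof (induction rule: integrable_induct)
    case (base A c)
    have "L1_class (\<lambda>x. c * indicator A x) = c *\<^sub>R ind A"
      unfolding ind_def using base by (intro L1_class_scale integrable_indicator_unit)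
    then show ?case using subspace_scale[OF S(1) set_S[OF base(1)]] by (simp add: mult.commute)
  next
    case (add f g)
    then show ?case using subspace_add[OF S(1)] by (simp add: L1_class_add)
  next
    case (lim f s)
    have "(\<lambda>i. L1_class (s i)) \<longlonglongrightarrow> L1_class f"
      by (rule L1_class_tendsto[where g = "\<lambda>x. 2 * \<bar>f x\<bar>"])
        (use lim in \<open>auto simp: space_restrict_space\<close>)
    then show ?case
      using closed_sequentially[OF S(2), of "\<lambda>i. L1_class (s i)"] lim by blast
  qed
  from this[of "rep_L1 F"] show ?thesis by simp
qed

lemma convergent_of_dyad:
  fixes L :: "nat \<Rightarrow> L1 \<Rightarrow> 'b::banach"
  assumes lin: "\<And>n. linear (L n)" and le: "\<And>n F. norm (L n F) \<le> C * norm F"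
    and conv: "\<And>j. j \<ge> 1 \<Longrightarrow> convergent (\<lambda>n. L n (ind (dyad j)))"
  shows "convergent (\<lambda>n. L n F)"
proof -
  let ?S = "{F. convergent (\<lambda>n. L n F)}"
  have "F \<in> ?S"
  proof (rule subspace_dyad_UNIV)
    show "subspace ?S"
      unfolding subspace_def
      by (auto simp: linear_0[OF lin] linear_add[OF lin] linear_scale[OF lin] convergent_const
          intro: convergent_add bounded_linear.convergent[OF bounded_linear_scaleR_right])
    show "closed ?S"
      unfolding closed_sequential_limits
    proof (intro allI impI, elim conjE)
      fix X G assume X: "\<forall>n. X n \<in> ?S" and lim: "X \<longlonglongrightarrow> G"
      have "Cauchy (\<lambda>n. L n G)"
      proof (rule metric_CauchyI)
        fix e :: real assume e: "e > 0"
        define d where "d = e / (3 * (\<bar>C\<bar> + 1))"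
        have d: "d > 0" using e by (auto simp: d_def)
        then obtain k where k: "dist (X k) G < d"
          using lim unfolding lim_sequentially by blast
        have "Cauchy (\<lambda>n. L n (X k))" using X by (auto intro: convergent_Cauchy)
        then obtain N where N: "\<And>m n. m \<ge> N \<Longrightarrow> n \<ge> N \<Longrightarrow> dist (L m (X k)) (L n (X k)) < e / 3"
          using e metric_CauchyD[of "\<lambda>n. L n (X k)" "e / 3"] by auto
        have close: "dist (L n G) (L n (X k)) < e / 3" for n
        proof -
          have "dist (L n G) (L n (X k)) \<le> C * norm (G - X k)"
            using le[of n "G - X k"] by (simp add: dist_norm linear_diff[OF lin])
          also have "\<dots> \<le> (\<bar>C\<bar> + 1) * norm (G - X k)" by (intro mult_right_mono) auto
          also have "\<dots> < (\<bar>C\<bar> + 1) * d"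
            using k by (intro mult_strict_left_mono) (auto simp: dist_norm norm_minus_commute)
          also have "\<dots> = e / 3" by (auto simp: d_def field_simps)
          finally show ?thesis .
        qed
        have "dist (L m G) (L n G) < e" if mn: "m \<ge> N" "n \<ge> N" for m n
        proof -
          have "dist (L m G) (L n G) \<le> dist (L m G) (L m (X k)) + dist (L m (X k)) (L n (X k)) + dist (L n (X k)) (L n G)"
            by metric
          then show ?thesis using close[of m] close[of n] N[OF mn] by (simp add: dist_commute)
        qed
        then show "\<exists>M. \<forall>m\<ge>M. \<forall>n\<ge>M. dist (L m G) (L n G) < e" by blast
      qed
      then show "G \<in> ?S" by (simp add: Cauchy_convergent_iff)
    qed
  qed (use conv in auto)
  then show ?thesis by simp
qed

lemma bounded_linear_eq_dyad:
  fixes f g :: "L1 \<Rightarrow> 'b::real_normed_vector"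
  assumes "bounded_linear f" "bounded_linear g" "\<And>j. j \<ge> 1 \<Longrightarrow> f (ind (dyad j)) = g (ind (dyad j))"
  shows "f F = g F"
proof -
  have "F \<in> {F. f F = g F}"
  proof (rule subspace_dyad_UNIV)
    show "subspace {F. f F = g F}"
      using assms(1,2)[THEN bounded_linear.linear]
      by (auto simp: subspace_def linear_0 linear_add linear_scale)
    show "closed {F. f F = g F}"
      using assms(1,2) by (intro closed_Collect_eq linear_continuous_on)
  qed (use assms(3) in auto)
  then show ?thesis by simp
qed

section \<open>Transfer of Haar expansions between trees\<close>

locale two_trees = A: halving_tree A + B: halving_tree B for A B :: "nat \<Rightarrow> real set"
begin

definition transfer_sum :: "nat \<Rightarrow> L1 \<Rightarrow> L1"
  where "transfer_sum N F =
    (\<Sum>n<N. (pair (A.haar_of n) F / (B.mass * weight n)) *\<^sub>R L1_class (B.haar_of n))"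

text \<open>The Haar terms telescope: the term with index \<open>N\<close> refines the averages over the nodes
  \<open>N, ..., 2N - 1\<close> by splitting node \<open>N\<close>. In this form the sums are visibly contractions.\<close>

lemma transfer_sum_level:
  assumes "N \<ge> 1"
  shows "transfer_sum N F =
    (\<Sum>m\<in>{N..<2 * N}. (pair (indicator (A m)) F / (B.mass * weight m)) *\<^sub>R ind (B m))"
  using assms
proof (induction N rule: nat_induct_at_least)
  case base
  have "A.haar_of 0 = indicator (A 1)" "B.haar_of 0 = indicator (B 1)"
    by (auto simp: A.haar_of_def B.haar_of_def)
  then show ?case by (simp add: transfer_sum_def numeral_2_eq_2 ind_def)
next
  case (Suc N)
  define p q where "p = pair (indicator (A (2 * N))) F" and "q = pair (indicator (A (2 * N + 1))) F"
  define u v where "u = ind (B (2 * N))" and "v = ind (B (2 * N + 1))"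
  define c where "c = 1 / (B.mass * weight N)"
  have "pair (\<lambda>x. indicator (A (2 * N)) x + indicator (A (2 * N + 1)) x) F = p + q"
    unfolding p_def q_def using Suc.hyps
    by (intro pair_add test_indicator A.sets_tree) auto
  then have pq: "pair (indicator (A N)) F = p + q"
    using A.indicator_children[OF Suc.hyps] by presburger
  have "ind (B N) = L1_class (\<lambda>x. indicator (B (2 * N)) x + indicator (B (2 * N + 1)) x)"
    unfolding ind_def using B.indicator_children[OF Suc.hyps] by presburger
  also have "\<dots> = u + v"
    unfolding u_def v_def ind_def using Suc.hyps
    by (intro L1_class_add integrable_indicator_unit B.sets_tree) auto
  finally have uv: "ind (B N) = u + v" .
  have w: "pair (indicator (A m)) F / (B.mass * weight m) = 2 * c * pair (indicator (A m)) F"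
    if "m = 2 * N \<or> m = 2 * N + 1" for m
    using that Suc.hyps by (auto simp: c_def)
  have "transfer_sum (Suc N) F = transfer_sum N F + (c * (p - q)) *\<^sub>R (u - v)"
    using Suc.hyps by (simp add: transfer_sum_def A.pair_haar_of B.class_haar_of p_def q_def u_def v_def c_def)
  also have "(c * (p - q)) *\<^sub>R (u - v) = - (c * (p + q)) *\<^sub>R (u + v) + (2 * c * p) *\<^sub>R u + (2 * c * q) *\<^sub>R v"
    by (simp add: algebra_simps scaleR_2[symmetric] del: scaleR_2)
  finally show ?case
    unfolding heap_level_step[OF Suc.hyps] Suc.IH
    by (simp add: w[simplified] pq uv) (simp add: p_def q_def u_def v_def c_def)
qed

lemma norm_transfer_sum_le: "norm (transfer_sum N F) \<le> norm F"
proof (cases "N \<ge> 1")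
  case True
  have "norm (transfer_sum N F) \<le>
      (\<Sum>m\<in>{N..<2 * N}. norm ((pair (indicator (A m)) F / (B.mass * weight m)) *\<^sub>R ind (B m)))"
    unfolding transfer_sum_level[OF True] by (rule norm_sum)
  also have "\<dots> = (\<Sum>m\<in>{N..<2 * N}. \<bar>pair (indicator (A m)) F\<bar>)"
  proof (intro sum.cong refl)
    fix m assume "m \<in> {N..<2 * N}"
    then have "m \<ge> 1" using True by auto
    then have "norm (ind (B m)) = B.mass * weight m"
      using B.measure_tree[of m] by (simp add: norm_ind B.sets_tree)
    moreover have "B.mass \<noteq> 0" using B.root_pos by linarith
    ultimately show "norm ((pair (indicator (A m)) F / (B.mass * weight m)) *\<^sub>R ind (B m)) = \<bar>pair (indicator (A m)) F\<bar>"
      by (simp add: abs_mult abs_divide abs_of_pos)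
  qed
  also have "\<dots> \<le> norm F" using True by (rule A.pair_level_le)
  finally show ?thesis .
qed (auto simp: transfer_sum_def not_le)

lemma linear_transfer_sum: "linear (transfer_sum N)"
  unfolding transfer_sum_def
  using bounded_linear_pair[OF A.test_haar_of, THEN bounded_linear.linear]
  by (intro linear_compose_sum) (auto intro!: linearI simp: linear_add linear_scale algebra_simps add_divide_distrib)

end

text \<open>The assumption makes the transfer sums of a dyadic step function stationary. For a tree that
  is built from the dyadic intervals it stands in for a martingale convergence theorem.\<close>

locale tree_transfer = two_trees +
  assumes vanish: "j \<ge> 1 \<Longrightarrow> \<forall>\<^sub>F n in sequentially. pair (A.haar_of n) (ind (dyad j)) = 0"
begin

definition "transfer F = lim (\<lambda>N. transfer_sum N F)"

lemma transfer_LIMSEQ: "(\<lambda>N. transfer_sum N F) \<longlonglongrightarrow> transfer F"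
proof -
  have "convergent (\<lambda>N. transfer_sum N F)"
  proof (rule convergent_of_dyad[where C = 1])
    fix j :: nat assume "j \<ge> 1"
    from vanish[OF this] obtain N where N: "\<And>n. n \<ge> N \<Longrightarrow> pair (A.haar_of n) (ind (dyad j)) = 0"
      unfolding eventually_sequentially by auto
    have "transfer_sum n (ind (dyad j)) = transfer_sum N (ind (dyad j))" if "n \<ge> N" for n
      unfolding transfer_sum_def using that N by (intro sum.mono_neutral_right) auto
    then have "(\<lambda>n. transfer_sum n (ind (dyad j))) \<longlonglongrightarrow> transfer_sum N (ind (dyad j))"
      by (intro tendsto_eventually eventually_sequentiallyI)
    then show "convergent (\<lambda>n. transfer_sum n (ind (dyad j)))" by (auto simp: convergent_def)
  qed (use norm_transfer_sum_le linear_transfer_sum in auto)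
  then show ?thesis by (simp add: transfer_def convergent_LIMSEQ_iff)
qed

lemma transfer_sums:
  "(\<lambda>n. (pair (A.haar_of n) F / (B.mass * weight n)) *\<^sub>R L1_class (B.haar_of n)) sums transfer F"
  using transfer_LIMSEQ[of F] by (simp add: sums_def transfer_sum_def)

lemma norm_transfer_le: "norm (transfer F) \<le> norm F"
  by (rule LIMSEQ_le_const2[OF tendsto_norm[OF transfer_LIMSEQ]]) (use norm_transfer_sum_le in blast)

lemma bounded_linear_transfer: "bounded_linear transfer"
proof (rule bounded_linear_intro[where K = 1])
  fix F G :: L1 and r :: real
  have "(\<lambda>N. transfer_sum N (F + G)) \<longlonglongrightarrow> transfer F + transfer G"
    unfolding linear_add[OF linear_transfer_sum] by (intro tendsto_add transfer_LIMSEQ)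
  then show "transfer (F + G) = transfer F + transfer G" by (rule LIMSEQ_unique[OF transfer_LIMSEQ])
  have "(\<lambda>N. transfer_sum N (r *\<^sub>R F)) \<longlonglongrightarrow> r *\<^sub>R transfer F"
    unfolding linear_scale[OF linear_transfer_sum] by (intro tendsto_scaleR tendsto_const transfer_LIMSEQ)
  then show "transfer (r *\<^sub>R F) = r *\<^sub>R transfer F" by (rule LIMSEQ_unique[OF transfer_LIMSEQ])
qed (use norm_transfer_le in auto)

lemma transfer_haar_of:
  "transfer (L1_class (A.haar_of n)) = (A.mass / B.mass) *\<^sub>R L1_class (B.haar_of n)"
proof -
  have "(\<lambda>k. (pair (A.haar_of k) (L1_class (A.haar_of n)) / (B.mass * weight k)) *\<^sub>R L1_class (B.haar_of k))
      sums (\<Sum>k\<in>{n}. (pair (A.haar_of k) (L1_class (A.haar_of n)) / (B.mass * weight k)) *\<^sub>R L1_class (B.haar_of k))"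
    by (rule sums_finite) (auto simp: A.haar_of_orthogonal)
  from sums_unique2[OF transfer_sums this] show ?thesis
    using weight_pos[of n] by (simp add: A.haar_of_orthogonal)
qed

end

lemma pair_haar_of_dyad_vanish:
  "j \<ge> 1 \<Longrightarrow> \<forall>\<^sub>F n in sequentially. pair (dyad.haar_of n) (ind (dyad j)) = 0"
  by (rule eventually_sequentiallyI[of j]) (auto intro: dyad.pair_haar_of_tree)

section \<open>The Haar system is a Schauder basis\<close>

interpretation dd: tree_transfer dyad dyad
  by unfold_locales (rule pair_haar_of_dyad_vanish)

text \<open>The indicator of \<open>D j\<close> is a step function for the partition \<open>D j, ..., D (2j - 1)\<close>, and later Haar
  functions have mean zero on \<open>D j\<close>.\<close>

lemma dyad_transfer_id: "dd.transfer F = F"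
proof (rule bounded_linear_eq_dyad[of dd.transfer "\<lambda>F. F" F])
  fix j :: nat assume j: "j \<ge> 1"
  have coeff: "(pair (indicator (dyad m)) (ind (dyad j)) / weight m) *\<^sub>R ind (dyad m) =
      (if m = j then ind (dyad j) else 0)" if m: "m \<in> {j..<2 * j}" for m
  proof -
    have "measure unit_leb (dyad m \<inter> dyad j) = (if m = j then weight j else 0)"
      using dyad.disjoint_level[of m j j] j m by (auto simp: measure_dyad)
    then show ?thesis using m j by (auto simp: pair_ind dyad.sets_tree)
  qed
  have "dd.transfer_sum n (ind (dyad j)) = ind (dyad j)" if "n \<ge> j" for n
  proof -
    have "dd.transfer_sum n (ind (dyad j)) = dd.transfer_sum j (ind (dyad j))"
      unfolding dd.transfer_sum_def using that j
      by (intro sum.mono_neutral_right) (auto intro!: dyad.pair_haar_of_tree)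
    also have "\<dots> = (\<Sum>m\<in>{j..<2 * j}. if m = j then ind (dyad j) else 0)"
      using coeff measure_dyad[of 1] by (simp add: dd.transfer_sum_level[OF j])
    also have "\<dots> = ind (dyad j)" using j by (simp add: sum.delta)
    finally show ?thesis .
  qed
  then have "(\<lambda>n. dd.transfer_sum n (ind (dyad j))) \<longlonglongrightarrow> ind (dyad j)"
    by (intro tendsto_eventually eventually_sequentiallyI)
  then show "dd.transfer (ind (dyad j)) = ind (dyad j)"
    by (rule LIMSEQ_unique[OF dd.transfer_LIMSEQ])
qed (auto intro: dd.bounded_linear_transfer)

lemma haar_expansion:
  "(\<lambda>n. (pair (haar_fun n) F / weight n) *\<^sub>R haar n) sums F"
  using dd.transfer_sums[of F] measure_dyad[of 1]
  by (simp add: haar_fun_eq haar_eq dyad_transfer_id)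

definition dyad_avg :: "nat \<Rightarrow> L1 \<Rightarrow> L1"
  where "dyad_avg N F = (\<Sum>m\<in>{N..<2 * N}. (pair (indicator (dyad m)) F / weight m) *\<^sub>R ind (dyad m))"

lemma dyad_avg_eq: "N \<ge> 1 \<Longrightarrow> dyad_avg N F = dd.transfer_sum N F"
  using measure_dyad[of 1] by (simp add: dyad_avg_def dd.transfer_sum_level)

lemma norm_dyad_avg_diff_le: "N \<ge> 1 \<Longrightarrow> norm (dyad_avg N F - dyad_avg N G) \<le> norm (F - G)"
  using dd.norm_transfer_sum_le[of N "F - G"]
  by (simp add: dyad_avg_eq linear_diff[OF dd.linear_transfer_sum])

lemma dyad_avg_haar_sum:
  "N \<ge> 1 \<Longrightarrow> dyad_avg N F = (\<Sum>n<N. (pair (haar_fun n) F / weight n) *\<^sub>R haar n)"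
  using measure_dyad[of 1] by (simp add: dyad_avg_eq dd.transfer_sum_def haar_fun_eq haar_eq)

lemma dyad_avg_LIMSEQ: "(\<lambda>N. dyad_avg N F) \<longlonglongrightarrow> F"
proof (rule Lim_transform_eventually)
  show "(\<lambda>N. dd.transfer_sum N F) \<longlonglongrightarrow> F"
    using dd.transfer_LIMSEQ[of F] by (simp add: dyad_transfer_id)
  show "\<forall>\<^sub>F N in sequentially. dd.transfer_sum N F = dyad_avg N F"
    by (rule eventually_sequentiallyI[of 1]) (simp add: dyad_avg_eq)
qed

lemma normalized_haar_eq: "normalized_haar n = (1 / weight n) *\<^sub>R haar n"
  by (simp add: normalized_haar_def norm_haar_weight)

lemma test_haar_fun: "test_fun (haar_fun n)"
  by (simp add: haar_fun_eq dyad.test_haar_of)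

lemma haar_expansion_normalized:
  "(\<lambda>n. pair (haar_fun n) F *\<^sub>R normalized_haar n) sums F"
  using haar_expansion[of F] by (simp add: normalized_haar_eq)

lemma pair_haar_fun_haar: "pair (haar_fun m) (haar n) = (if m = n then weight n else 0)"
  using dyad.haar_of_orthogonal[of m n] by (simp add: haar_fun_eq haar_eq)

lemma haar_coefficients_unique:
  assumes "(\<lambda>n. a n *\<^sub>R normalized_haar n) sums F"
  shows "a = (\<lambda>n. pair (haar_fun n) F)"
proof
  fix m
  have "(\<lambda>n. pair (haar_fun m) (a n *\<^sub>R normalized_haar n)) sums pair (haar_fun m) F"
    by (rule bounded_linear.sums[OF bounded_linear_pair[OF test_haar_fun] assms])
  moreover have "(\<lambda>n. pair (haar_fun m) (a n *\<^sub>R normalized_haar n)) = (\<lambda>n. if n = m then a m else 0)"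
    using weight_pos
    by (auto simp: fun_eq_iff normalized_haar_eq pair_haar_fun_haar less_imp_neq[symmetric]
        linear_scale[OF bounded_linear.linear[OF bounded_linear_pair[OF test_haar_fun]]])
  ultimately have "(\<lambda>n. if n = m then a m else 0) sums pair (haar_fun m) F" by simp
  with sums_If_finite_set[of "{m}" "\<lambda>_. a m"] show "a m = pair (haar_fun m) F"
    by (auto intro: sums_unique2)
qed

lemma normalized_schauder_basis_haar: "normalized_schauder_basis normalized_haar"
  unfolding normalized_schauder_basis_def schauder_basis_def
proof (intro conjI allI)
  fix F show "\<exists>!a. (\<lambda>n. a n *\<^sub>R normalized_haar n) sums F"
    using haar_expansion_normalized haar_coefficients_unique by (rule ex1I)
next
  fix n show "norm (normalized_haar n) = 1"
    using weight_pos[of n] by (simp add: normalized_haar_eq norm_haar_weight)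
qed

lemma biorth_normalized_haar: "biorth normalized_haar n F = pair (haar_fun n) F"
proof -
  have "(THE a. (\<lambda>k. a k *\<^sub>R normalized_haar k) sums F) = (\<lambda>n. pair (haar_fun n) F)"
    using haar_expansion_normalized haar_coefficients_unique by (intro the_equality) auto
  then show ?thesis by (simp add: biorth_def)
qed

section \<open>The diagonal part of an operator\<close>

lemma sum_weight_level: "N \<ge> 1 \<Longrightarrow> (\<Sum>m\<in>{N..<2 * N}. weight m) = 1"
proof (induction N rule: nat_induct_at_least)
  case base
  then show ?case by (simp add: numeral_2_eq_2)
next
  case (Suc N)
  then show ?case using heap_level_step[of N weight] by simp
qed

text \<open>Summability along the heap makes sums over partitions tend to 0.\<close>

lemma sum_level_tendsto_0:
  fixes f :: "nat \<Rightarrow> real"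
  assumes "summable f"
  shows "(\<lambda>N. \<Sum>m\<in>{N..<2 * N}. f m) \<longlonglongrightarrow> 0"
proof -
  have "(\<lambda>N. (\<Sum>m<2 * N. f m) - (\<Sum>m<N. f m)) \<longlonglongrightarrow> suminf f - suminf f"
    using summable_LIMSEQ[OF assms]
    by (intro tendsto_diff) (auto intro!: filterlim_compose[of "\<lambda>n. \<Sum>m<n. f m" _ sequentially "\<lambda>N. 2 * N"]
        filterlim_subseq simp: strict_mono_def)
  moreover have "(\<Sum>m<2 * N. f m) - (\<Sum>m<N. f m) = (\<Sum>m\<in>{N..<2 * N}. f m)" for N
    using sum_diff_nat_ivl[of 0 N "2 * N" f] by (simp add: lessThan_atLeast0)
  ultimately show ?thesis by simp
qed

lemma ind_dyad_children: "n \<ge> 1 \<Longrightarrow> ind (dyad n) = ind (dyad (2 * n)) + ind (dyad (2 * n + 1))"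
  using ind_eq_sum[of "{2 * n, 2 * n + 1}" dyad "dyad n"] dyad.indicator_children[of n]
    dyad.sets_tree[of "2 * n"] dyad.sets_tree[of "2 * n + 1"]
  by auto

lemma norm_ind_dyad: "n \<ge> 1 \<Longrightarrow> norm (ind (dyad n)) = weight n"
  by (simp add: norm_ind dyad.sets_tree measure_dyad)

lemma mulop_add: "test_fun g \<Longrightarrow> test_fun h \<Longrightarrow> mulop (\<lambda>x. g x + h x) F = mulop g F + mulop h F"
  unfolding mulop_def distrib_right by (intro L1_class_add test_integrable) auto

lemma mulop_mulop:
  assumes "test_fun g" "test_fun h"
  shows "mulop g (mulop h F) = mulop (\<lambda>x. g x * h x) F"
  unfolding mulop_def[of h] using assms
  by (subst mulop_class[where c = 1]) (auto simp: test_integrable test_fun_def mulop_def mult.assoc)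

lemma linear_mulop: "test_fun g \<Longrightarrow> bounded_linear (mulop g)"
  by (rule bounded_linear_mulop[where c = 1]) (auto simp: test_fun_def)

lemma norm_mulop_le: "test_fun g \<Longrightarrow> norm (mulop g F) \<le> norm F"
  using bounded_linear_mulop(2)[of g 1 F] by (auto simp: test_fun_def)

lemma abs_pair_le_mulop:
  assumes "test_fun g"
  shows "\<bar>pair g F\<bar> \<le> norm (mulop g F)"
proof -
  have "norm (mulop g F) = (\<integral>x. \<bar>g x * rep_L1 F x\<bar> \<partial>unit_leb)"
    unfolding mulop_def using assms by (intro norm_L1_class test_integrable) auto
  then show ?thesis unfolding pair_def using integral_abs_bound by metis
qed

lemma test_dyad: "m \<ge> 1 \<Longrightarrow> test_fun (indicator (dyad m))"
  by (intro test_indicator dyad.sets_tree)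

lemma test_not_dyad: "m \<ge> 1 \<Longrightarrow> test_fun (\<lambda>x. 1 - indicator (dyad m) x)"
  using borel_measurable_diff[OF borel_measurable_const test_measurable[OF test_dyad], of m 1]
  by (auto simp: test_fun_def indicator_def)

locale L1_operator =
  fixes T :: "L1 \<Rightarrow> L1"
  assumes bounded_linear_T: "bounded_linear T"
begin

lemma T_add: "T (F + G) = T F + T G" and T_diff: "T (F - G) = T F - T G"
  using bounded_linear_T by (auto simp: linear_simps)

lemma T_le: "norm (T F) \<le> onorm T * norm F"
  by (rule onorm[OF bounded_linear_T])

text \<open>The truncation of \<open>T\<close> to the diagonal blocks of the \<open>N\<close>-th partition, applied to the constant
  function 1. If \<open>T\<close> is multiplication by \<open>a\<close>, then this is \<open>a\<close> for every \<open>N\<close>.\<close>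

definition diag_part :: "nat \<Rightarrow> L1"
  where "diag_part N = (\<Sum>m\<in>{N..<2 * N}. mulop (indicator (dyad m)) (T (ind (dyad m))))"

text \<open>It grows with \<open>N\<close> and stays below the norm of \<open>T\<close>; this monotonicity replaces the modulus of the
  operator \<open>T\<close> in the proof that the diagonal parts converge.\<close>

definition off_mass :: "nat \<Rightarrow> real"
  where "off_mass N = (\<Sum>m\<in>{N..<2 * N}. norm (mulop (\<lambda>x. 1 - indicator (dyad m) x) (T (ind (dyad m)))))"

definition cross :: "nat \<Rightarrow> real"
  where "cross m = norm (mulop (indicator (dyad (2 * m))) (T (ind (dyad (2 * m + 1))))) +
    norm (mulop (indicator (dyad (2 * m + 1))) (T (ind (dyad (2 * m)))))"

lemma cross_nonneg [simp]: "cross m \<ge> 0"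
  by (simp add: cross_def)

lemma off_mass_nonneg: "off_mass N \<ge> 0"
  by (simp add: off_mass_def sum_nonneg)

lemma off_mass_le: "N \<ge> 1 \<Longrightarrow> off_mass N \<le> onorm T"
proof -
  assume N: "N \<ge> 1"
  have "off_mass N \<le> (\<Sum>m\<in>{N..<2 * N}. onorm T * weight m)"
    unfolding off_mass_def
  proof (rule sum_mono)
    fix m assume "m \<in> {N..<2 * N}"
    then have m: "m \<ge> 1" using N by auto
    have "norm (mulop (\<lambda>x. 1 - indicator (dyad m) x) (T (ind (dyad m)))) \<le> norm (T (ind (dyad m)))"
      by (rule norm_mulop_le[OF test_not_dyad[OF m]])
    also have "\<dots> \<le> onorm T * weight m"
      using T_le[of "ind (dyad m)"] by (simp only: norm_ind_dyad[OF m])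
    finally show "norm (mulop (\<lambda>x. 1 - indicator (dyad m) x) (T (ind (dyad m)))) \<le> onorm T * weight m" .
  qed
  also have "\<dots> = onorm T" using N by (simp add: sum_distrib_left[symmetric] sum_weight_level)
  finally show ?thesis .
qed

text \<open>When \<open>D N\<close> is split, the exchange between its halves becomes off-diagonal, and by the triangle
  inequality the mass that left \<open>D N\<close> before is still counted.\<close>

lemma cross_le_off_mass:
  assumes N: "N \<ge> 1"
  shows "cross N \<le> off_mass (Suc N) - off_mass N"
proof -
  define c where "c m = (\<lambda>x. 1 - indicator (dyad m) x :: real)" for m
  have tc: "test_fun (c m)" if "m \<ge> 1" for m using test_not_dyad[OF that] by (simp add: c_def)
  define l r where "l = 2 * N" and "r = 2 * N + 1"
  have lr: "l \<ge> 1" "r \<ge> 1" using N by (auto simp: l_def r_def)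
  have eqI: "(indicator (dyad N) x :: real) = indicator (dyad l) x + indicator (dyad r) x" for x
    using dyad.indicator_children[OF N] by (simp add: l_def r_def)
  have split: "norm (mulop (c N) F) + norm (mulop (indicator (dyad k')) F) \<le> norm (mulop (c k) F)"
    if k: "(k = l \<and> k' = r) \<or> (k = r \<and> k' = l)" for k k' F
  proof -
    have t: "test_fun (c k)" "test_fun (c N)" "test_fun (indicator (dyad k'))"
      using k lr N tc test_dyad by auto
    have p: "c N x * c k x = c N x" "indicator (dyad k') x * c k x = indicator (dyad k') x"
      "\<bar>c N x\<bar> + \<bar>indicator (dyad k') x\<bar> \<le> (1::real)" for x
      using k eqI[of x] dyad.disjoint[OF N] unfolding c_def l_def r_def
      by (auto simp: indicator_def split: if_splits)
    have "(\<Sum>b\<in>{True, False}. norm (mulop (if b then c N else indicator (dyad k')) (mulop (c k) F)))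
        \<le> norm (mulop (c k) F)"
      using t p(3) by (intro mulop_sum_le) auto
    then show ?thesis using t by (simp add: mulop_mulop p)
  qed
  have "T (ind (dyad N)) = T (ind (dyad l)) + T (ind (dyad r))"
    using ind_dyad_children[OF N] by (simp add: T_add l_def r_def)
  then have "norm (mulop (c N) (T (ind (dyad N)))) \<le>
      norm (mulop (c N) (T (ind (dyad l)))) + norm (mulop (c N) (T (ind (dyad r))))"
    using bounded_linear.linear[OF linear_mulop[OF tc[OF N]], THEN linear_add] norm_triangle_ineq by metis
  moreover have "off_mass (Suc N) - off_mass N = norm (mulop (c l) (T (ind (dyad l)))) +
      norm (mulop (c r) (T (ind (dyad r)))) - norm (mulop (c N) (T (ind (dyad N))))"
    unfolding off_mass_def heap_level_step[OF N] by (simp add: c_def l_def r_def)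
  ultimately show ?thesis
    using split[of l r "T (ind (dyad l))"] split[of r l "T (ind (dyad r))"]
    by (simp add: cross_def l_def[symmetric] r_def[symmetric] add.commute)
       (simp add: cross_def l_def r_def)
qed

text \<open>The increments of \<open>off_mass\<close> telescope, and \<open>off_mass\<close> is bounded by the norm of \<open>T\<close>. This one
  series controls both the convergence of the diagonal parts and their relation to the Haar
  diagonal.\<close>

lemma summable_cross: "summable cross"
proof -
  have "(\<Sum>i<n. cross (Suc i)) \<le> onorm T" for n
  proof -
    have "(\<Sum>i<n. cross (Suc i)) \<le> (\<Sum>i<n. off_mass (Suc (Suc i)) - off_mass (Suc i))"
      by (intro sum_mono cross_le_off_mass) auto
    also have "\<dots> = off_mass (Suc n) - off_mass 1"
      by (subst sum_lessThan_telescope[of "\<lambda>i. off_mass (Suc i)"]) simp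
    also have "\<dots> \<le> onorm T" using off_mass_le[of "Suc n"] off_mass_nonneg[of 1] by linarith
    finally show ?thesis .
  qed
  then have "summable (\<lambda>i. cross (Suc i))" by (intro summableI_nonneg_bounded[of _ "onorm T"]) auto
  then show ?thesis by (simp add: summable_Suc_iff)
qed

lemma diag_part_step:
  assumes N: "N \<ge> 1"
  shows "norm (diag_part (Suc N) - diag_part N) \<le> cross N"
proof -
  define l r where "l = 2 * N" and "r = 2 * N + 1"
  have lr: "l \<ge> 1" "r \<ge> 1" using N by (auto simp: l_def r_def)
  have lin: "mulop (indicator (dyad m)) (F + G) = mulop (indicator (dyad m)) F + mulop (indicator (dyad m)) G"
    if "m \<ge> 1" for m F G
    using bounded_linear.linear[OF linear_mulop[OF test_dyad[OF that]], THEN linear_add] .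
  have "mulop (indicator (dyad N)) F = mulop (indicator (dyad l)) F + mulop (indicator (dyad r)) F" for F
  proof -
    have "indicator (dyad N) = (\<lambda>x. indicator (dyad l) x + indicator (dyad r) x :: real)"
      using dyad.indicator_children[OF N] by (auto simp: l_def r_def)
    then show ?thesis using lr by (simp add: mulop_add test_dyad)
  qed
  then have "diag_part (Suc N) - diag_part N =
      - (mulop (indicator (dyad l)) (T (ind (dyad r))) + mulop (indicator (dyad r)) (T (ind (dyad l))))"
    unfolding diag_part_def heap_level_step[OF N]
    using ind_dyad_children[OF N] lr by (simp add: T_add lin l_def r_def)
  then show ?thesis unfolding cross_def l_def r_def by (simp only: norm_minus_cancel) (rule norm_triangle_ineq)
qed

definition diag_lim :: L1
  where "diag_lim = lim diag_part"

lemma diag_part_LIMSEQ: "diag_part \<longlonglongrightarrow> diag_lim"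
proof -
  have "summable (\<lambda>i. diag_part (Suc (Suc i)) - diag_part (Suc i))"
  proof (rule summable_comparison_test')
    show "summable (\<lambda>i. cross (Suc i))" using summable_cross by (simp add: summable_Suc_iff)
    show "norm (diag_part (Suc (Suc i)) - diag_part (Suc i)) \<le> cross (Suc i)" if "i \<ge> 0" for i
      by (rule diag_part_step) simp
  qed
  then have "(\<lambda>n. \<Sum>i<n. diag_part (Suc (Suc i)) - diag_part (Suc i)) \<longlonglongrightarrow>
      (\<Sum>i. diag_part (Suc (Suc i)) - diag_part (Suc i))" by (rule summable_LIMSEQ)
  then have "(\<lambda>n. diag_part (Suc n) - diag_part (Suc 0)) \<longlonglongrightarrow>
      (\<Sum>i. diag_part (Suc (Suc i)) - diag_part (Suc i))"
    by (subst (asm) sum_lessThan_telescope[of "\<lambda>i. diag_part (Suc i)"])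
  then have "convergent (\<lambda>n. (diag_part (Suc n) - diag_part (Suc 0)) + diag_part (Suc 0))"
    by (intro convergent_add convergent_const) (auto simp: convergent_def)
  then have "convergent (\<lambda>n. diag_part (Suc n))" by simp
  then have "convergent diag_part" using convergent_Suc_iff by blast
  then show ?thesis by (simp add: diag_lim_def convergent_LIMSEQ_iff)
qed

lemma pair_diag_part:
  assumes k: "k \<in> {N..<2 * N}"
  shows "pair (indicator (dyad k)) (diag_part N) = pair (indicator (dyad k)) (T (ind (dyad k)))"
proof -
  have tk: "test_fun (indicator (dyad k))" and k1: "k \<ge> 1" using k test_dyad[of k] by auto
  have "pair (indicator (dyad k)) (diag_part N) =
      (\<Sum>m\<in>{N..<2 * N}. pair (indicator (dyad k)) (mulop (indicator (dyad m)) (T (ind (dyad m)))))"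
    unfolding diag_part_def using bounded_linear.linear[OF bounded_linear_pair[OF tk]] by (simp add: linear_sum)
  also have "\<dots> = (\<Sum>m\<in>{N..<2 * N}. if m = k then pair (indicator (dyad k)) (T (ind (dyad k))) else 0)"
  proof (intro sum.cong refl)
    fix m assume m: "m \<in> {N..<2 * N}"
    then have "(\<lambda>x. indicator (dyad k) x * indicator (dyad m) x :: real) =
        (if m = k then indicator (dyad k) else (\<lambda>_. 0))"
      using dyad.disjoint_level[of m N k] k by (auto simp: fun_eq_iff indicator_def)
    moreover have "test_fun (indicator (dyad m))" using m test_dyad[of m] by auto
    ultimately show "pair (indicator (dyad k)) (mulop (indicator (dyad m)) (T (ind (dyad m)))) =
        (if m = k then pair (indicator (dyad k)) (T (ind (dyad k))) else 0)"
      using tk by (simp add: pair_mulop) (simp add: pair_def)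
  qed
  also have "\<dots> = pair (indicator (dyad k)) (T (ind (dyad k)))" using k by simp
  finally show ?thesis .
qed

text \<open>Expanding both Haar functions into the two halves leaves the two diagonal terms and two mixed
  terms; the mixed terms are cross terms.\<close>

lemma haar_diag_approx:
  assumes m: "m \<ge> 1"
  shows "\<bar>pair (haar_fun m) (T (haar m)) - (pair (indicator (dyad (2 * m))) (T (ind (dyad (2 * m)))) +
      pair (indicator (dyad (2 * m + 1))) (T (ind (dyad (2 * m + 1)))))\<bar> \<le> cross m"
proof -
  define l r where "l = 2 * m" and "r = 2 * m + 1"
  have lr: "test_fun (indicator (dyad l))" "test_fun (indicator (dyad r))"
    using m test_dyad by (auto simp: l_def r_def)
  have "pair (haar_fun m) (T (haar m)) =
      pair (indicator (dyad l)) (T (ind (dyad l)) - T (ind (dyad r))) -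
      pair (indicator (dyad r)) (T (ind (dyad l)) - T (ind (dyad r)))"
    using m by (simp add: haar_eq haar_fun_eq dyad.pair_haar_of dyad.class_haar_of T_diff l_def r_def)
  also have "\<dots> = pair (indicator (dyad l)) (T (ind (dyad l))) + pair (indicator (dyad r)) (T (ind (dyad r)))
      - pair (indicator (dyad l)) (T (ind (dyad r))) - pair (indicator (dyad r)) (T (ind (dyad l)))"
    using lr[THEN bounded_linear_pair, THEN bounded_linear.linear] by (simp add: linear_diff)
  finally show ?thesis
    using abs_pair_le_mulop[OF lr(1), of "T (ind (dyad r))"] abs_pair_le_mulop[OF lr(2), of "T (ind (dyad l))"]
    unfolding cross_def l_def r_def by linarith
qed

lemma pair_diag_part_children:
  assumes m: "m \<in> {N..<2 * N}"
  shows "pair (indicator (dyad m)) (diag_part (2 * N)) = pair (indicator (dyad (2 * m))) (T (ind (dyad (2 * m)))) +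
      pair (indicator (dyad (2 * m + 1))) (T (ind (dyad (2 * m + 1))))"
proof -
  have m1: "m \<ge> 1" using m by auto
  have "indicator (dyad m) = (\<lambda>x. indicator (dyad (2 * m)) x + indicator (dyad (2 * m + 1)) x :: real)"
    using dyad.indicator_children[OF m1] by auto
  then have "pair (indicator (dyad m)) F = pair (indicator (dyad (2 * m))) F + pair (indicator (dyad (2 * m + 1))) F" for F
    using m1 by (simp add: pair_add test_dyad)
  then show ?thesis using m pair_diag_part[of "2 * m" "2 * N"] pair_diag_part[of "2 * m + 1" "2 * N"] by auto
qed

text \<open>The averages of \<open>diag_part (2 * N)\<close> over the \<open>N\<close>-th partition have the same limit as
  \<open>diag_part\<close>, and in norm they differ from the Haar diagonal by at most the sum of \<open>cross\<close> over the partition.\<close>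

lemma haar_diag_LIMSEQ:
  "(\<lambda>N. \<Sum>m\<in>{N..<2 * N}. (pair (haar_fun m) (T (haar m)) / weight m) *\<^sub>R ind (dyad m)) \<longlonglongrightarrow> diag_lim"
  (is "?s \<longlonglongrightarrow> _")
proof -
  have sub: "(\<lambda>N. diag_part (2 * N)) \<longlonglongrightarrow> diag_lim"
    by (rule filterlim_compose[OF diag_part_LIMSEQ]) (auto intro!: filterlim_subseq simp: strict_mono_def)
  have "(\<lambda>N. ?s N - dyad_avg N (diag_part (2 * N))) \<longlonglongrightarrow> 0"
  proof (rule Lim_null_comparison)
    show "(\<lambda>N. \<Sum>m\<in>{N..<2 * N}. cross m) \<longlonglongrightarrow> 0"
      by (rule sum_level_tendsto_0[OF summable_cross])
    have "norm (?s N - dyad_avg N (diag_part (2 * N))) \<le> (\<Sum>m\<in>{N..<2 * N}. cross m)" for N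
    proof -
      define d where "d m = pair (haar_fun m) (T (haar m)) - pair (indicator (dyad m)) (diag_part (2 * N))" for m
      have "?s N - dyad_avg N (diag_part (2 * N)) = (\<Sum>m\<in>{N..<2 * N}. (d m / weight m) *\<^sub>R ind (dyad m))"
        by (simp add: dyad_avg_def d_def sum_subtractf[symmetric] scaleR_left_diff_distrib[symmetric] diff_divide_distrib)
      also have "norm \<dots> \<le> (\<Sum>m\<in>{N..<2 * N}. norm ((d m / weight m) *\<^sub>R ind (dyad m)))"
        by (rule norm_sum)
      also have "\<dots> \<le> (\<Sum>m\<in>{N..<2 * N}. cross m)"
      proof (rule sum_mono)
        fix m assume m: "m \<in> {N..<2 * N}"
        then have m1: "m \<ge> 1" by auto
        have "norm ((d m / weight m) *\<^sub>R ind (dyad m)) = \<bar>d m\<bar>"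
          using m1 by (simp add: norm_ind_dyad)
        also have "\<dots> \<le> cross m"
          using haar_diag_approx[OF m1] unfolding d_def pair_diag_part_children[OF m] .
        finally show "norm ((d m / weight m) *\<^sub>R ind (dyad m)) \<le> cross m" .
      qed
      finally show ?thesis .
    qed
    then show "\<forall>\<^sub>F N in sequentially. norm (?s N - dyad_avg N (diag_part (2 * N))) \<le> (\<Sum>m\<in>{N..<2 * N}. cross m)"
      by simp
  qed
  moreover have "(\<lambda>N. dyad_avg N (diag_part (2 * N)) - dyad_avg N diag_lim) \<longlonglongrightarrow> 0"
  proof (rule Lim_null_comparison)
    show "(\<lambda>N. norm (diag_part (2 * N) - diag_lim)) \<longlonglongrightarrow> 0"
      using sub LIM_zero tendsto_norm_zero by blast
    show "\<forall>\<^sub>F N in sequentially. norm (dyad_avg N (diag_part (2 * N)) - dyad_avg N diag_lim) \<le> norm (diag_part (2 * N) - diag_lim)"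
      by (rule eventually_sequentiallyI[of 1]) (rule norm_dyad_avg_diff_le)
  qed
  ultimately have "(\<lambda>N. (?s N - dyad_avg N (diag_part (2 * N))) +
      (dyad_avg N (diag_part (2 * N)) - dyad_avg N diag_lim) + dyad_avg N diag_lim) \<longlonglongrightarrow> 0 + 0 + diag_lim"
    by (intro tendsto_add dyad_avg_LIMSEQ)
  then show ?thesis by simp
qed

text \<open>The step functions of the preceding lemma have modulus at least \<open>\<delta>\<close> and converge in norm, so the
  integral of the positive part of \<open>\<delta> - |a|\<close> is zero, where \<open>a\<close> represents \<open>diag_lim\<close>.\<close>

lemma diag_lim_ge:
  assumes d: "\<And>n. n \<ge> 1 \<Longrightarrow> \<bar>pair (haar_fun n) (T (haar n))\<bar> \<ge> \<delta> * weight n"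
  shows "AE x in unit_leb. \<bar>rep_L1 diag_lim x\<bar> \<ge> \<delta>"
proof -
  define \<alpha> where "\<alpha> = rep_L1 diag_lim"
  have \<alpha>[simp]: "integrable unit_leb \<alpha>" and [measurable]: "\<alpha> \<in> borel_measurable unit_leb" by (auto simp: \<alpha>_def)
  define d where "d m = pair (haar_fun m) (T (haar m)) / weight m" for m
  define s where "s N x = (\<Sum>m\<in>{N..<2 * N}. d m * indicator (dyad m) x)" for N x
  \<comment> \<open>Positive exactly where the claim fails; the norm distance to the step functions dominates it.\<close>
  define gap where "gap x = max 0 (\<delta> - \<bar>\<alpha> x\<bar>)" for x
  have int_ind: "integrable unit_leb (indicator (dyad m) :: real \<Rightarrow> real)" if "m \<ge> 1" for m
    by (intro integrable_indicator_unit dyad.sets_tree that)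
  have int_s: "integrable unit_leb (s N)" for N
    unfolding s_def[abs_def]
    by (intro Bochner_Integration.integrable_sum
        Bochner_Integration.integrable_mult_right int_ind) auto
  have s_class: "L1_class (s N) = (\<Sum>m\<in>{N..<2 * N}. d m *\<^sub>R ind (dyad m))" for N
    unfolding s_def[abs_def] ind_def
    by (subst L1_class_sum) (auto intro!: int_ind sum.cong L1_class_scale)
  have int_gap: "integrable unit_leb gap"
    unfolding gap_def by (intro integrable_max integrable_diff integrable_abs \<alpha>)
       (auto intro: finite_measure.integrable_const[OF finite_measure_unit_leb])
  have null: "{1::real} \<in> null_sets unit_leb" by (auto simp: null_sets_restrict_space)
  have "(\<integral>x. gap x \<partial>unit_leb) \<le> norm (L1_class (s N) - diag_lim)" if N: "N \<ge> 1" for N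
  proof -
    have "L1_class (s N) - diag_lim = L1_class (\<lambda>x. s N x - \<alpha> x)"
      using int_s by (simp add: L1_class_diff) (simp add: \<alpha>_def)
    then have "norm (L1_class (s N) - diag_lim) = (\<integral>x. \<bar>s N x - \<alpha> x\<bar> \<partial>unit_leb)"
      using int_s by (simp add: norm_L1_class)
    moreover have "(\<integral>x. gap x \<partial>unit_leb) \<le> (\<integral>x. \<bar>s N x - \<alpha> x\<bar> \<partial>unit_leb)"
    proof (rule integral_mono_AE[OF int_gap])
      show "integrable unit_leb (\<lambda>x. \<bar>s N x - \<alpha> x\<bar>)" using int_s by auto
      show "AE x in unit_leb. gap x \<le> \<bar>s N x - \<alpha> x\<bar>"
      proof (rule AE_mp[OF AE_not_in[OF null] AE_I2], intro impI)
        fix x assume "x \<in> space unit_leb" "x \<notin> {1::real}"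
        then have "x \<in> dyad 1" by (auto simp: dyad_1 space_restrict_space)
        then have "(\<Sum>m\<in>{N..<2 * N}. indicator (dyad m) x) = (1::real)"
          using dyad.indicator_level[OF N, of x] by simp
        then have "(\<Sum>m\<in>{N..<2 * N}. indicator (dyad m) x) \<noteq> (0::real)" by simp
        then obtain k where k: "k \<in> {N..<2 * N}" "x \<in> dyad k"
          by (rule sum.not_neutral_contains_not_neutral) (auto simp: indicator_def split: if_splits)
        have "s N x = (\<Sum>m\<in>{N..<2 * N}. if m = k then d k else 0)"
          unfolding s_def using k dyad.disjoint_level[of _ N k]
          by (intro sum.cong refl) (auto simp: indicator_def)
        then have "s N x = d k" using k by simp
        moreover have "\<bar>d k\<bar> \<ge> \<delta>" using d[of k] k N by (simp add: d_def field_simps)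
        ultimately show "gap x \<le> \<bar>s N x - \<alpha> x\<bar>" unfolding gap_def by auto
      qed
    qed
    ultimately show ?thesis by simp
  qed
  moreover have "(\<lambda>N. norm (L1_class (s N) - diag_lim)) \<longlonglongrightarrow> 0"
    using haar_diag_LIMSEQ unfolding s_class d_def by (intro tendsto_norm_zero LIM_zero)
  ultimately have "(\<integral>x. gap x \<partial>unit_leb) \<le> 0"
    by (intro LIMSEQ_le_const[of "\<lambda>N. norm (L1_class (s N) - diag_lim)"]) auto
  moreover have "gap x \<ge> 0" for x by (simp add: gap_def)
  ultimately have "AE x in unit_leb. gap x = 0"
    using integral_nonneg_eq_0_iff_AE[OF int_gap] integral_nonneg_AE[where f = gap and M = unit_leb] by fastforce
  then show ?thesis by eventually_elim (auto simp: gap_def \<alpha>_def)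
qed

lemma small_diag:
  assumes "diag_lim = 0"
  shows "(\<lambda>N. \<Sum>m\<in>{N..<2 * N}. \<bar>pair (indicator (dyad m)) (T (ind (dyad m)))\<bar>) \<longlonglongrightarrow> 0"
    and "(\<lambda>N. \<Sum>m\<in>{N..<2 * N}. \<bar>pair (haar_fun m) (T (haar m))\<bar>) \<longlonglongrightarrow> 0"
proof -
  have lim: "(\<lambda>N. norm (diag_part N)) \<longlonglongrightarrow> 0"
    using diag_part_LIMSEQ assms tendsto_norm_zero by force
  have le: "(\<Sum>m\<in>{N..<2 * N}. \<bar>pair (indicator (dyad m)) (diag_part K)\<bar>) \<le> norm (diag_part K)" for N K
    by (cases "N \<ge> 1") (auto intro: dyad.pair_level_le simp: not_le)
  show "(\<lambda>N. \<Sum>m\<in>{N..<2 * N}. \<bar>pair (indicator (dyad m)) (T (ind (dyad m)))\<bar>) \<longlonglongrightarrow> 0"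
  proof (rule Lim_null_comparison[OF always_eventually[OF allI] lim])
    fix N
    have "(\<Sum>m\<in>{N..<2 * N}. \<bar>pair (indicator (dyad m)) (T (ind (dyad m)))\<bar>) =
        (\<Sum>m\<in>{N..<2 * N}. \<bar>pair (indicator (dyad m)) (diag_part N)\<bar>)"
      by (intro sum.cong refl) (simp add: pair_diag_part)
    then show "norm (\<Sum>m\<in>{N..<2 * N}. \<bar>pair (indicator (dyad m)) (T (ind (dyad m)))\<bar>) \<le> norm (diag_part N)"
      using le[of N N] by (simp add: sum_nonneg)
  qed
  show "(\<lambda>N. \<Sum>m\<in>{N..<2 * N}. \<bar>pair (haar_fun m) (T (haar m))\<bar>) \<longlonglongrightarrow> 0"
  proof (rule Lim_null_comparison)
    show "(\<lambda>N. norm (diag_part (2 * N)) + (\<Sum>m\<in>{N..<2 * N}. cross m)) \<longlonglongrightarrow> 0"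
    proof (rule tendsto_add_zero)
      show "(\<lambda>N. norm (diag_part (2 * N))) \<longlonglongrightarrow> 0"
        by (rule filterlim_compose[OF lim]) (auto intro!: filterlim_subseq simp: strict_mono_def)
    qed (rule sum_level_tendsto_0[OF summable_cross])
    have sum_le: "(\<Sum>m\<in>{N..<2 * N}. \<bar>pair (haar_fun m) (T (haar m))\<bar>) \<le>
        (\<Sum>m\<in>{N..<2 * N}. \<bar>pair (indicator (dyad m)) (diag_part (2 * N))\<bar> + cross m)" for N
    proof (rule sum_mono)
      fix m assume m: "m \<in> {N..<2 * N}"
      then have "m \<ge> 1" by auto
      from haar_diag_approx[OF this] show "\<bar>pair (haar_fun m) (T (haar m))\<bar> \<le>
          \<bar>pair (indicator (dyad m)) (diag_part (2 * N))\<bar> + cross m"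
        unfolding pair_diag_part_children[OF m] by linarith
    qed
    have "(\<Sum>m\<in>{N..<2 * N}. \<bar>pair (haar_fun m) (T (haar m))\<bar>) \<le>
        norm (diag_part (2 * N)) + (\<Sum>m\<in>{N..<2 * N}. cross m)" for N
      using le[where N = N and K = "2 * N"] sum_le[of N] unfolding sum.distrib by linarith
    then show "\<forall>\<^sub>F N in sequentially. norm (\<Sum>m\<in>{N..<2 * N}. \<bar>pair (haar_fun m) (T (haar m))\<bar>) \<le>
        norm (diag_part (2 * N)) + (\<Sum>m\<in>{N..<2 * N}. cross m)"
      by (simp add: sum_nonneg)
  qed
qed

end

section \<open>Random signs\<close>

text \<open>A choice of signs is encoded by the set of indices with sign \<open>+ 1\<close>. The mean over all choices
  becomes a sum over a power set and can be computed by induction on the index set.\<close>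

definition signum_of :: "'a set \<Rightarrow> 'a \<Rightarrow> real"
  where "signum_of X m = (if m \<in> X then 1 else - 1)"

lemma sum_Pow_insert:
  fixes \<phi> :: "'a set \<Rightarrow> real"
  assumes "finite M" "a \<notin> M"
  shows "(\<Sum>X\<in>Pow (insert a M). \<phi> X) = (\<Sum>X\<in>Pow M. \<phi> X + \<phi> (insert a X))"
proof -
  have "(\<Sum>X\<in>Pow (insert a M). \<phi> X) = (\<Sum>X\<in>Pow M. \<phi> X) + (\<Sum>X\<in>insert a ` Pow M. \<phi> X)"
    unfolding Pow_insert using assms by (intro sum.union_disjoint) auto
  also have "(\<Sum>X\<in>insert a ` Pow M. \<phi> X) = (\<Sum>X\<in>Pow M. \<phi> (insert a X))"
    using assms by (subst sum.reindex) (auto simp: inj_on_def)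
  finally show ?thesis by (simp add: sum.distrib)
qed

lemma signum_of_insert:
  "a \<notin> M \<Longrightarrow> m \<in> M \<Longrightarrow> signum_of (insert a X) m = signum_of X m"
  by (auto simp: signum_of_def)

text \<open>Independent random signs are orthonormal.\<close>

lemma sum_signs_linear:
  assumes "finite M"
  shows "(\<Sum>X\<in>Pow M. (\<Sum>m\<in>M. signum_of X m * y m)\<^sup>2) = 2 ^ card M * (\<Sum>m\<in>M. (y m)\<^sup>2)"
  using assms
proof (induction M)
  case (insert a M)
  define L where "L X = (\<Sum>m\<in>M. signum_of X m * y m)" for X
  have 1: "(\<Sum>m\<in>insert a M. signum_of X m * y m) = L X - y a" if "X \<in> Pow M" for X
    using insert.hyps that by (auto simp: L_def signum_of_def[of X a])
  have 2: "(\<Sum>m\<in>insert a M. signum_of (insert a X) m * y m) = L X + y a" if "X \<in> Pow M" for X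
    using insert.hyps that by (simp add: L_def signum_of_insert signum_of_def[of _ a] cong: sum.cong)
  have "(\<Sum>X\<in>Pow (insert a M). (\<Sum>m\<in>insert a M. signum_of X m * y m)\<^sup>2) =
      (\<Sum>X\<in>Pow M. 2 * (L X)\<^sup>2 + 2 * (y a)\<^sup>2)"
    unfolding sum_Pow_insert[OF insert.hyps]
    by (intro sum.cong refl) (simp only: 1 2, simp add: power2_eq_square algebra_simps)
  also have "\<dots> = 2 * (2 ^ card M * (\<Sum>m\<in>M. (y m)\<^sup>2)) + 2 ^ card M * (2 * (y a)\<^sup>2)"
    using insert.IH insert.hyps by (simp add: L_def sum.distrib sum_distrib_left[symmetric] card_Pow)
  finally show ?case using insert.hyps by (simp add: algebra_simps)
qed simp

text \<open>A new index \<open>a\<close> adds to the quadratic form its sign times a linear form \<open>L\<close> in the old signs.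
  The product with the old form cancels between the two signs of \<open>a\<close>, and the mean of the square
  of \<open>L\<close> is known.\<close>

lemma sum_signs_quadratic:
  fixes x :: "'a \<Rightarrow> 'a \<Rightarrow> real"
  assumes "finite M" and diag: "\<And>m. x m m = 0"
  shows "(\<Sum>X\<in>Pow M. (\<Sum>m\<in>M. \<Sum>k\<in>M. signum_of X m * signum_of X k * x m k)\<^sup>2)
    \<le> 2 ^ card M * (2 * (\<Sum>m\<in>M. \<Sum>k\<in>M. (x m k)\<^sup>2))"
  using assms(1)
proof (induction M)
  case (insert a M)
  define Q where "Q X = (\<Sum>m\<in>M. \<Sum>k\<in>M. signum_of X m * signum_of X k * x m k)" for X
  define L where "L X = (\<Sum>k\<in>M. signum_of X k * (x a k + x k a))" for X
  have split: "(\<Sum>m\<in>insert a M. \<Sum>k\<in>insert a M. s m * s k * x m k) =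
      (\<Sum>m\<in>M. \<Sum>k\<in>M. s m * s k * x m k) + s a * (\<Sum>k\<in>M. s k * (x a k + x k a))" for s :: "'a \<Rightarrow> real"
    using insert.hyps by (simp add: diag sum.distrib sum_distrib_left algebra_simps)
  have 1: "(\<Sum>m\<in>insert a M. \<Sum>k\<in>insert a M. signum_of X m * signum_of X k * x m k) = Q X - L X"
    if "X \<in> Pow M" for X
    using insert.hyps that unfolding split by (auto simp: Q_def L_def signum_of_def[of X a])
  have 2: "(\<Sum>m\<in>insert a M. \<Sum>k\<in>insert a M. signum_of (insert a X) m * signum_of (insert a X) k * x m k) = Q X + L X"
    if "X \<in> Pow M" for X
    using insert.hyps that unfolding split
    by (simp add: Q_def L_def signum_of_insert signum_of_def[of _ a] cong: sum.cong)
  have L: "(\<Sum>X\<in>Pow M. (L X)\<^sup>2) \<le> 2 ^ card M * (2 * (\<Sum>k\<in>M. (x a k)\<^sup>2 + (x k a)\<^sup>2))"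
  proof -
    have "(\<Sum>X\<in>Pow M. (L X)\<^sup>2) = 2 ^ card M * (\<Sum>k\<in>M. (x a k + x k a)\<^sup>2)"
      unfolding L_def by (rule sum_signs_linear[OF insert.hyps(1)])
    also have "\<dots> \<le> 2 ^ card M * (\<Sum>k\<in>M. 2 * ((x a k)\<^sup>2 + (x k a)\<^sup>2))"
    proof (intro mult_left_mono sum_mono)
      fix k show "(x a k + x k a)\<^sup>2 \<le> 2 * ((x a k)\<^sup>2 + (x k a)\<^sup>2)"
        using sum_squares_ge_zero[of "x a k - x k a" 0] by (simp add: power2_eq_square algebra_simps)
    qed auto
    finally show ?thesis by (simp add: sum_distrib_left)
  qed
  have "(\<Sum>X\<in>Pow (insert a M). (\<Sum>m\<in>insert a M. \<Sum>k\<in>insert a M. signum_of X m * signum_of X k * x m k)\<^sup>2) =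
      (\<Sum>X\<in>Pow M. 2 * (Q X)\<^sup>2 + 2 * (L X)\<^sup>2)"
    unfolding sum_Pow_insert[OF insert.hyps]
    by (intro sum.cong refl) (simp only: 1 2, simp add: power2_eq_square algebra_simps)
  also have "\<dots> = 2 * (\<Sum>X\<in>Pow M. (Q X)\<^sup>2) + 2 * (\<Sum>X\<in>Pow M. (L X)\<^sup>2)"
    by (simp add: sum.distrib sum_distrib_left)
  also have "\<dots> \<le> 2 * (2 ^ card M * (2 * (\<Sum>m\<in>M. \<Sum>k\<in>M. (x m k)\<^sup>2))) +
      2 * (2 ^ card M * (2 * (\<Sum>k\<in>M. (x a k)\<^sup>2 + (x k a)\<^sup>2)))"
    using insert.IH L by (simp add: Q_def)
  also have "\<dots> = 2 ^ card (insert a M) * (2 * (\<Sum>m\<in>insert a M. \<Sum>k\<in>insert a M. (x m k)\<^sup>2))"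
    using insert.hyps by (simp add: diag sum.distrib algebra_simps)
  finally show ?case .
qed simp

text \<open>Some choice of signs does not exceed the mean of the sum of all the squares, so one choice makes
  all of these forms small.\<close>

lemma exists_signs:
  fixes x :: "'a \<Rightarrow> 'a \<Rightarrow> real" and y :: "'i \<Rightarrow> 'a \<Rightarrow> real"
  assumes "finite M" "finite G" and diag: "\<And>m. x m m = 0"
  obtains X where "(\<Sum>m\<in>M. \<Sum>k\<in>M. signum_of X m * signum_of X k * x m k)\<^sup>2 +
      (\<Sum>g\<in>G. (\<Sum>m\<in>M. signum_of X m * y g m)\<^sup>2)
    \<le> 2 * (\<Sum>m\<in>M. \<Sum>k\<in>M. (x m k)\<^sup>2) + (\<Sum>g\<in>G. \<Sum>m\<in>M. (y g m)\<^sup>2)"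
proof -
  define \<Phi> where "\<Phi> X = (\<Sum>m\<in>M. \<Sum>k\<in>M. signum_of X m * signum_of X k * x m k)\<^sup>2 +
      (\<Sum>g\<in>G. (\<Sum>m\<in>M. signum_of X m * y g m)\<^sup>2)" for X
  define B where "B = 2 * (\<Sum>m\<in>M. \<Sum>k\<in>M. (x m k)\<^sup>2) + (\<Sum>g\<in>G. \<Sum>m\<in>M. (y g m)\<^sup>2)"
  have "(\<Sum>X\<in>Pow M. \<Sum>g\<in>G. (\<Sum>m\<in>M. signum_of X m * y g m)\<^sup>2) = 2 ^ card M * (\<Sum>g\<in>G. \<Sum>m\<in>M. (y g m)\<^sup>2)"
    using sum_signs_linear[OF assms(1)] by (subst sum.swap) (simp add: sum_distrib_left)
  then have le: "(\<Sum>X\<in>Pow M. \<Phi> X) \<le> (\<Sum>X\<in>Pow M. B)"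
    using sum_signs_quadratic[of M x] assms by (simp add: \<Phi>_def B_def sum.distrib card_Pow distrib_left)
  have "\<exists>X\<in>Pow M. \<Phi> X \<le> B"
  proof (rule ccontr)
    assume "\<not> (\<exists>X\<in>Pow M. \<Phi> X \<le> B)"
    then have "(\<Sum>X\<in>Pow M. B) < (\<Sum>X\<in>Pow M. \<Phi> X)"
      using assms(1) by (intro sum_strict_mono) (auto simp: not_le)
    then show False using le by simp
  qed
  then show thesis using that by (auto simp: \<Phi>_def B_def)
qed

section \<open>Signed blocks of Haar functions\<close>

definition block :: "nat set \<Rightarrow> nat set \<Rightarrow> real \<Rightarrow> real"
  where "block M X x = (\<Sum>m\<in>M. signum_of X m * haar_fun m x)"

context
  fixes N :: nat and M :: "nat set"
  assumes N: "N \<ge> 1" and M: "M \<subseteq> {N..<2 * N}"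
begin

lemma block_finite: "finite M"
  using M finite_subset by blast

lemma block_index_pos: "m \<in> M \<Longrightarrow> m \<ge> 1"
  using M N by auto

lemma block_eq_on_dyad:
  assumes "m \<in> M" "x \<in> dyad m"
  shows "block M X x = signum_of X m * haar_fun m x"
proof -
  have "block M X x = (\<Sum>k\<in>M. if k = m then signum_of X m * haar_fun m x else 0)"
    unfolding block_def
  proof (intro sum.cong refl)
    fix k assume k: "k \<in> M"
    show "signum_of X k * haar_fun k x = (if k = m then signum_of X m * haar_fun m x else 0)"
    proof (cases "k = m")
      case False
      then have "dyad k \<inter> dyad m = {}" using dyad.disjoint_level[of k N m] k assms M by blast
      then have "\<bar>haar_fun k x\<bar> = 0"
        using dyad.abs_haar_of[of k x] block_index_pos[OF k] assms by (auto simp: haar_fun_eq indicator_def)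
      then show ?thesis using False by simp
    qed simp
  qed
  then show ?thesis using assms block_finite by simp
qed

lemma block_eq_0:
  assumes "x \<notin> (\<Union>m\<in>M. dyad m)"
  shows "block M X x = 0"
proof -
  have "haar_fun m x = 0" if "m \<in> M" for m
  proof -
    have "\<bar>haar_fun m x\<bar> = 0"
      using dyad.abs_haar_of[of m x] block_index_pos[OF that] assms that by (auto simp: haar_fun_eq indicator_def)
    then show ?thesis by simp
  qed
  then show ?thesis by (simp add: block_def)
qed

lemma haar_fun_cases:
  assumes "m \<ge> 1" "x \<in> dyad m"
  shows "haar_fun m x = (if x \<in> dyad (2 * m) then 1 else - 1)"
    and "x \<in> dyad (2 * m + 1) \<longleftrightarrow> x \<notin> dyad (2 * m)"
  using assms dyad.split[of m] dyad.disjoint[of m] by (auto simp: haar_fun_eq dyad.haar_of_def indicator_def)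

lemma block_values: "block M X x \<in> {- 1, 0, 1}"
  and block_nonzero: "block M X x \<noteq> 0 \<longleftrightarrow> x \<in> (\<Union>m\<in>M. dyad m)"
proof -
  show "block M X x \<in> {- 1, 0, 1}" 
  proof (cases "x \<in> (\<Union>m\<in>M. dyad m)")
    case True
    then obtain m where m: "m \<in> M" "x \<in> dyad m" by auto
    then show ?thesis
      using block_eq_on_dyad[OF m, of X] haar_fun_cases[OF block_index_pos m(2)] by (auto simp: signum_of_def)
  qed (use block_eq_0 in auto)
  show "block M X x \<noteq> 0 \<longleftrightarrow> x \<in> (\<Union>m\<in>M. dyad m)"
  proof (cases "x \<in> (\<Union>m\<in>M. dyad m)")
    case True
    then obtain m where m: "m \<in> M" "x \<in> dyad m" by auto
    then show ?thesis using True
      using block_eq_on_dyad[OF m, of X] haar_fun_cases[OF block_index_pos m(2)] by (auto simp: signum_of_def)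
  qed (use block_eq_0 in auto)
qed

text \<open>A block equals \<open>1\<close> on one half of each of its intervals and \<open>- 1\<close> on the other half. The two level
  sets are again unions of dyadic intervals, and so they can carry further blocks.\<close>

lemma block_level_set:
  assumes "s = 1 \<or> s = - 1"
  shows "\<exists>M'\<subseteq>{2 * N..<2 * (2 * N)}. {x. block M X x = s} = (\<Union>m\<in>M'. dyad m)"
proof -
  define c where "c m = (if signum_of X m = s then 2 * m else 2 * m + 1)" for m
  have eq: "block M X x = s \<longleftrightarrow> x \<in> dyad (c m)" if m: "m \<in> M" "x \<in> dyad m" for m x
    using block_eq_on_dyad[OF m, of X] haar_fun_cases[OF block_index_pos[OF m(1)] m(2)] assms
    by (auto simp: c_def signum_of_def)
  have sub: "dyad (c m) \<subseteq> dyad m" if "m \<in> M" for m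
    using dyad.split[OF block_index_pos[OF that]] by (auto simp: c_def)
  have "{x. block M X x = s} = (\<Union>m\<in>c ` M. dyad m)"
  proof (intro set_eqI iffI)
    fix x assume "x \<in> {x. block M X x = s}"
    then have x: "block M X x = s" by simp
    then have "x \<in> (\<Union>m\<in>M. dyad m)" using block_nonzero[of X x] assms by auto
    then obtain m where m: "m \<in> M" "x \<in> dyad m" by auto
    then show "x \<in> (\<Union>m\<in>c ` M. dyad m)" using eq[OF m] x by auto
  next
    fix x assume "x \<in> (\<Union>m\<in>c ` M. dyad m)"
    then obtain m where m: "m \<in> M" "x \<in> dyad (c m)" by auto
    then show "x \<in> {x. block M X x = s}" using eq[OF m(1)] sub[OF m(1)] by auto
  qed
  moreover have "c ` M \<subseteq> {2 * N..<2 * (2 * N)}" using M by (auto simp: c_def)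
  ultimately show ?thesis by blast
qed

lemma test_block: "test_fun (block M X)"
proof -
  have "\<bar>block M X x\<bar> \<le> 1" for x using block_values[of X x] by auto
  moreover have "block M X \<in> borel_measurable unit_leb"
    unfolding block_def[abs_def]
    by (intro borel_measurable_sum borel_measurable_times borel_measurable_const test_measurable test_haar_fun)
  ultimately show ?thesis by (auto simp: test_fun_def)
qed

lemma class_block: "L1_class (block M X) = (\<Sum>m\<in>M. signum_of X m *\<^sub>R haar m)"
  unfolding block_def[abs_def] haar_def
  by (subst L1_class_sum) (auto intro!: integrable_haar_fun sum.cong L1_class_scale)

lemma pair_block: "pair (block M X) F = (\<Sum>m\<in>M. signum_of X m * pair (haar_fun m) F)"
  unfolding block_def[abs_def] by (intro pair_sum test_haar_fun)

lemma pair_block_dyad: "1 \<le> j \<Longrightarrow> j < 2 * N \<Longrightarrow> pair (block M X) (ind (dyad j)) = 0"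
  unfolding pair_block using M
  by (intro sum.neutral ballI) (auto simp: haar_fun_eq intro!: dyad.pair_haar_of_tree)

text \<open>A block tests only the Haar coefficients with index between \<open>N\<close> and \<open>2N\<close>, that is, the difference
  of two partial sums. So blocks tend weakly to 0, uniformly in their signs.\<close>

lemma pair_block_le: "\<bar>pair (block M X) F\<bar> \<le> norm (dyad_avg (2 * N) F - dyad_avg N F)"
proof -
  define c where "c n = pair (haar_fun n) F / weight n" for n
  have "dyad_avg (2 * N) F - dyad_avg N F = (\<Sum>n\<in>{N..<2 * N}. c n *\<^sub>R haar n)"
    using N sum_diff_nat_ivl[of 0 N "2 * N" "\<lambda>n. c n *\<^sub>R haar n"]
    by (simp add: dyad_avg_haar_sum c_def lessThan_atLeast0)
  then have "pair (haar_fun m) (dyad_avg (2 * N) F - dyad_avg N F) = pair (haar_fun m) F" if "m \<in> M" for m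
  proof -
    have "pair (haar_fun m) (\<Sum>n\<in>{N..<2 * N}. c n *\<^sub>R haar n) = (\<Sum>n\<in>{N..<2 * N}. c n * pair (haar_fun m) (haar n))"
      using bounded_linear_pair[OF test_haar_fun, THEN bounded_linear.linear]
      by (simp add: linear_sum linear_scale)
    also have "\<dots> = (\<Sum>n\<in>{N..<2 * N}. if n = m then pair (haar_fun m) F else 0)"
      by (intro sum.cong refl) (auto simp: pair_haar_fun_haar c_def)
    also have "\<dots> = pair (haar_fun m) F" using that M by auto
    finally show ?thesis using \<open>dyad_avg (2 * N) F - dyad_avg N F = _\<close> by simp
  qed
  then have "pair (block M X) F = pair (block M X) (dyad_avg (2 * N) F - dyad_avg N F)"
    unfolding pair_block by simp
  then show ?thesis using pair_le[OF test_block] by metis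
qed

end

lemma dyad_union_refine:
  assumes "N0 \<ge> 1" "M0 \<subseteq> {N0..<2 * N0}" "N \<ge> N0"
  shows "\<exists>M\<subseteq>{N..<2 * N}. (\<Union>m\<in>M0. dyad m) = (\<Union>m\<in>M. dyad m)"
  using assms(3)
proof (induction N rule: dec_induct)
  case base
  then show ?case using assms by blast
next
  case (step N)
  then obtain M where M: "M \<subseteq> {N..<2 * N}" "(\<Union>m\<in>M0. dyad m) = (\<Union>m\<in>M. dyad m)" by blast
  have N1: "N \<ge> 1" using step assms by simp
  show ?case
  proof (cases "N \<in> M")
    case True
    let ?M = "M - {N} \<union> {2 * N, 2 * N + 1}"
    have "(\<Union>m\<in>M. dyad m) = (\<Union>m\<in>M - {N}. dyad m) \<union> dyad N" using True by auto
    also have "\<dots> = (\<Union>m\<in>?M. dyad m)" unfolding dyad.split[OF N1] by auto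
    finally have "(\<Union>m\<in>M0. dyad m) = (\<Union>m\<in>?M. dyad m)" using M by simp
    moreover have "?M \<subseteq> {Suc N..<2 * Suc N}" using M N1 by (auto simp: subset_iff le_less)
    ultimately show ?thesis by blast
  next
    case False
    then have "M \<subseteq> {Suc N..<2 * Suc N}" using M by (auto simp: subset_iff Suc_le_eq le_less) 
    then show ?thesis using M by blast
  qed
qed

context L1_operator
begin

text \<open>Each term is at most the square of \<open>onorm T * weight k\<close>; the weights add up to 1, and each is
  at most \<open>2 / N\<close>.\<close>

lemma haar_entries_square_sum:
  assumes N: "N \<ge> 1"
  shows "(\<Sum>k\<in>{N..<2 * N}. (norm (T (haar k)))\<^sup>2) \<le> 2 * (onorm T)\<^sup>2 / N"
proof -
  have K: "onorm T \<ge> 0" by (rule onorm_pos_le[OF bounded_linear_T])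
  have "(\<Sum>k\<in>{N..<2 * N}. (norm (T (haar k)))\<^sup>2) \<le> (\<Sum>k\<in>{N..<2 * N}. (onorm T)\<^sup>2 * (2 / N) * weight k)"
  proof (rule sum_mono)
    fix k assume k: "k \<in> {N..<2 * N}"
    have "norm (T (haar k)) \<le> onorm T * weight k" using T_le[of "haar k"] by (simp add: norm_haar_weight)
    then have "(norm (T (haar k)))\<^sup>2 \<le> (onorm T * weight k)\<^sup>2" by (intro power_mono) auto
    also have "\<dots> = (onorm T)\<^sup>2 * weight k * weight k" by (simp add: power2_eq_square)
    also have "\<dots> \<le> (onorm T)\<^sup>2 * (2 / N) * weight k"
    proof (intro mult_right_mono mult_left_mono)
      have "weight k \<le> 2 / k" using k N by (intro weight_le) auto
      also have "\<dots> \<le> 2 / N" using k N by (intro divide_left_mono) auto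
      finally show "weight k \<le> 2 / N" .
    qed (auto intro: less_imp_le)
    finally show "(norm (T (haar k)))\<^sup>2 \<le> (onorm T)\<^sup>2 * (2 / N) * weight k" .
  qed
  also have "\<dots> = (onorm T)\<^sup>2 * (2 / N)"
    using sum_weight_level[OF N] by (simp only: sum_distrib_left[symmetric] mult_1_right)
  finally show ?thesis by (simp add: mult.commute)
qed

text \<open>For large \<open>N\<close>, the diagonal sum in \<open>\<langle>r, T r\<rangle>\<close> is small because \<open>T\<close> has no multiplication part.
  The remaining quadratic form in the signs and the linear forms \<open>\<langle>g, T r\<rangle>\<close> have coefficients
  with small square sum, so suitable signs make all of them small. The numbers \<open>\<langle>r, F\<rangle>\<close> are small
  for all signs, since blocks tend weakly to 0.\<close>

lemma exists_small_block:
  assumes zero: "diag_lim = 0" and N0: "N0 \<ge> 1" "M0 \<subseteq> {N0..<2 * N0}"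
    and G: "finite G" "\<And>g. g \<in> G \<Longrightarrow> test_fun g" and H: "finite H" and \<theta>: "\<theta> > 0"
  shows "\<exists>N M X. N \<ge> n \<and> N \<ge> 1 \<and> M \<subseteq> {N..<2 * N} \<and> (\<Union>m\<in>M0. dyad m) = (\<Union>m\<in>M. dyad m) \<and>
    \<bar>pair (block M X) (T (L1_class (block M X)))\<bar> \<le> \<theta> \<and>
    (\<forall>g\<in>G. \<bar>pair g (T (L1_class (block M X)))\<bar> \<le> \<theta>) \<and>
    (\<forall>F\<in>H. \<bar>pair (block M X) F\<bar> \<le> \<theta>)"
proof -
  have lim_avg: "(\<lambda>N. norm (dyad_avg (2 * N) F - dyad_avg N F)) \<longlonglongrightarrow> 0" for F
  proof -
    have "(\<lambda>N. dyad_avg (2 * N) F - dyad_avg N F) \<longlonglongrightarrow> F - F"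
      by (intro tendsto_diff dyad_avg_LIMSEQ filterlim_compose[OF dyad_avg_LIMSEQ])
        (auto intro!: filterlim_subseq simp: strict_mono_def)
    then show ?thesis by (simp add: tendsto_norm_zero)
  qed
  have "\<forall>\<^sub>F N in sequentially. \<forall>F\<in>H. norm (dyad_avg (2 * N) F - dyad_avg N F) < \<theta>"
    using H \<theta> lim_avg by (intro eventually_ball_finite ballI order_tendstoD(2)[of _ 0]) auto
  moreover have "\<forall>\<^sub>F N in sequentially. (\<Sum>m\<in>{N..<2 * N}. \<bar>pair (haar_fun m) (T (haar m))\<bar>) < \<theta> / 2"
    using small_diag(2)[OF zero] \<theta> by (intro order_tendstoD) auto
  moreover have "\<forall>\<^sub>F N in sequentially. (2 + card G) * (2 * (onorm T)\<^sup>2 / real N) < (\<theta> / 2)\<^sup>2"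
  proof (rule order_tendstoD)
    have "(\<lambda>N. (2 + card G) * (2 * (onorm T)\<^sup>2) * (1 / real N)) \<longlonglongrightarrow> (2 + card G) * (2 * (onorm T)\<^sup>2) * 0"
      by (intro tendsto_mult tendsto_const lim_1_over_n)
    then show "(\<lambda>N. (2 + card G) * (2 * (onorm T)\<^sup>2 / real N)) \<longlonglongrightarrow> 0" by simp
  qed (use \<theta> in auto)
  moreover have "\<forall>\<^sub>F N in sequentially. N \<ge> max n N0" by (rule eventually_ge_at_top)
  ultimately have "\<forall>\<^sub>F N in sequentially. (\<forall>F\<in>H. norm (dyad_avg (2 * N) F - dyad_avg N F) < \<theta>) \<and>
      (\<Sum>m\<in>{N..<2 * N}. \<bar>pair (haar_fun m) (T (haar m))\<bar>) < \<theta> / 2 \<and>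
      (2 + card G) * (2 * (onorm T)\<^sup>2 / real N) < (\<theta> / 2)\<^sup>2 \<and> N \<ge> max n N0"
    by eventually_elim auto
  from eventually_happens'[OF sequentially_bot this]
  obtain N where NH: "\<And>F. F \<in> H \<Longrightarrow> norm (dyad_avg (2 * N) F - dyad_avg N F) < \<theta>"
    and Nd: "(\<Sum>m\<in>{N..<2 * N}. \<bar>pair (haar_fun m) (T (haar m))\<bar>) < \<theta> / 2"
    and Nr: "(2 + card G) * (2 * (onorm T)\<^sup>2 / real N) < (\<theta> / 2)\<^sup>2"
    and Nn: "N \<ge> n" "N \<ge> N0"
    by auto
  have N1: "N \<ge> 1" using Nn N0 by simp
  obtain M where M: "M \<subseteq> {N..<2 * N}" "(\<Union>m\<in>M0. dyad m) = (\<Union>m\<in>M. dyad m)"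
    using dyad_union_refine[OF N0 Nn(2)] by blast
  have fin: "finite M" using M finite_subset by blast
  \<comment> \<open>The diagonal is treated separately, since it does not depend on the signs.\<close>
  define x where "x m k = (if m = k then 0 else pair (haar_fun m) (T (haar k)))" for m k
  define y where "y g m = pair g (T (haar m))" for g m
  have sq: "(\<Sum>k\<in>M. (norm (T (haar k)))\<^sup>2) \<le> 2 * (onorm T)\<^sup>2 / N"
  proof -
    have "(\<Sum>k\<in>M. (norm (T (haar k)))\<^sup>2) \<le> (\<Sum>k\<in>{N..<2 * N}. (norm (T (haar k)))\<^sup>2)"
      using M by (intro sum_mono2) auto
    then show ?thesis using haar_entries_square_sum[OF N1] by linarith
  qed
  have x_bound: "(\<Sum>m\<in>M. \<Sum>k\<in>M. (x m k)\<^sup>2) \<le> 2 * (onorm T)\<^sup>2 / N"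
  proof -
    have "(\<Sum>m\<in>M. (x m k)\<^sup>2) \<le> (norm (T (haar k)))\<^sup>2" for k
    proof -
      have le: "(\<Sum>m\<in>M. \<bar>pair (haar_fun m) (T (haar k))\<bar>) \<le> norm (T (haar k))"
      proof (rule pair_sum_le[OF fin test_haar_fun])
        fix x
        have "(\<Sum>m\<in>M. \<bar>haar_fun m x\<bar>) = (\<Sum>m\<in>M. indicator (dyad m) x)"
          using M N1 by (intro sum.cong refl) (auto simp: haar_fun_eq dyad.abs_haar_of)
        also have "\<dots> \<le> (\<Sum>m\<in>{N..<2 * N}. indicator (dyad m) x)"
          using M by (intro sum_mono2) auto
        also have "\<dots> \<le> 1" by (subst dyad.indicator_level[OF N1]) (simp add: indicator_def)
        finally show "(\<Sum>m\<in>M. \<bar>haar_fun m x\<bar>) \<le> 1" .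
      qed
      have "(\<Sum>m\<in>M. (x m k)\<^sup>2) \<le> (\<Sum>m\<in>M. norm (T (haar k)) * \<bar>pair (haar_fun m) (T (haar k))\<bar>)"
      proof (rule sum_mono)
        fix m
        have "\<bar>pair (haar_fun m) (T (haar k))\<bar> * \<bar>pair (haar_fun m) (T (haar k))\<bar> \<le>
            norm (T (haar k)) * \<bar>pair (haar_fun m) (T (haar k))\<bar>"
          by (intro mult_right_mono pair_le test_haar_fun) auto
        then show "(x m k)\<^sup>2 \<le> norm (T (haar k)) * \<bar>pair (haar_fun m) (T (haar k))\<bar>"
          by (auto simp: x_def power2_eq_square)
      qed
      also have "\<dots> \<le> norm (T (haar k)) * norm (T (haar k))"
        unfolding sum_distrib_left[symmetric] by (intro mult_left_mono le) auto
      finally show ?thesis by (simp add: power2_eq_square)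
    qed
    then have "(\<Sum>k\<in>M. \<Sum>m\<in>M. (x m k)\<^sup>2) \<le> (\<Sum>k\<in>M. (norm (T (haar k)))\<^sup>2)" by (rule sum_mono)
    then show ?thesis using sq sum.swap[of "\<lambda>m k. (x m k)\<^sup>2" M M] by linarith
  qed
  have y_bound: "(\<Sum>g\<in>G. \<Sum>m\<in>M. (y g m)\<^sup>2) \<le> card G * (2 * (onorm T)\<^sup>2 / N)"
  proof -
    have "(\<Sum>m\<in>M. (y g m)\<^sup>2) \<le> 2 * (onorm T)\<^sup>2 / N" if "g \<in> G" for g
    proof -
      have "(\<Sum>m\<in>M. (y g m)\<^sup>2) \<le> (\<Sum>m\<in>M. (norm (T (haar m)))\<^sup>2)"
        unfolding y_def using pair_le[OF G(2)[OF that]] by (intro sum_mono) (simp add: abs_le_square_iff[symmetric])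
      then show ?thesis using sq by linarith
    qed
    then show ?thesis by (rule sum_bounded_above)
  qed
  obtain X where X: "(\<Sum>m\<in>M. \<Sum>k\<in>M. signum_of X m * signum_of X k * x m k)\<^sup>2 +
      (\<Sum>g\<in>G. (\<Sum>m\<in>M. signum_of X m * y g m)\<^sup>2)
    \<le> 2 * (\<Sum>m\<in>M. \<Sum>k\<in>M. (x m k)\<^sup>2) + (\<Sum>g\<in>G. \<Sum>m\<in>M. (y g m)\<^sup>2)"
    by (rule exists_signs[OF fin G(1), of x y]) (auto simp: x_def)
  define Q where "Q = (\<Sum>m\<in>M. \<Sum>k\<in>M. signum_of X m * signum_of X k * x m k)"
  define L where "L g = (\<Sum>m\<in>M. signum_of X m * y g m)" for g
  have "Q\<^sup>2 + (\<Sum>g\<in>G. (L g)\<^sup>2) \<le> (2 + card G) * (2 * (onorm T)\<^sup>2 / real N)"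
    using X x_bound y_bound unfolding Q_def L_def of_nat_add of_nat_numeral distrib_right by linarith
  then have QL: "Q\<^sup>2 + (\<Sum>g\<in>G. (L g)\<^sup>2) \<le> (\<theta> / 2)\<^sup>2" using Nr by linarith
  have "Q\<^sup>2 \<le> (\<theta> / 2)\<^sup>2" using QL sum_nonneg[of G "\<lambda>g. (L g)\<^sup>2"] by simp
  then have Q_le: "\<bar>Q\<bar> \<le> \<theta> / 2" using \<theta> by (simp add: abs_le_square_iff[symmetric])
  have L_le: "\<bar>L g\<bar> \<le> \<theta>" if "g \<in> G" for g
  proof -
    have "(L g)\<^sup>2 \<le> (\<Sum>g\<in>G. (L g)\<^sup>2)" using that G(1) by (intro member_le_sum) auto
    then have "(L g)\<^sup>2 \<le> (\<theta> / 2)\<^sup>2" using QL zero_le_power2[of Q] by linarith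
    then have "\<bar>L g\<bar> \<le> \<theta> / 2" using \<theta> by (simp add: abs_le_square_iff[symmetric])
    then show ?thesis using \<theta> by simp
  qed
  have T_block: "T (L1_class (block M X)) = (\<Sum>k\<in>M. signum_of X k *\<^sub>R T (haar k))"
    using bounded_linear.linear[OF bounded_linear_T] by (simp add: class_block[OF N1 M(1)] linear_sum linear_scale)
  have pair_T: "pair g (T (L1_class (block M X))) = (\<Sum>k\<in>M. signum_of X k * pair g (T (haar k)))"
    if "test_fun g" for g
    using bounded_linear.linear[OF bounded_linear_pair[OF that]]
    by (simp add: T_block linear_sum linear_scale)
  have "pair (block M X) (T (L1_class (block M X))) =
      (\<Sum>m\<in>M. signum_of X m * (\<Sum>k\<in>M. signum_of X k * pair (haar_fun m) (T (haar k))))"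
    unfolding pair_block[OF N1 M(1)] by (simp add: pair_T test_haar_fun)
  also have "\<dots> = (\<Sum>m\<in>M. pair (haar_fun m) (T (haar m)) + (\<Sum>k\<in>M. signum_of X m * signum_of X k * x m k))"
  proof (intro sum.cong refl)
    fix m assume m: "m \<in> M"
    have "signum_of X m * (\<Sum>k\<in>M. signum_of X k * pair (haar_fun m) (T (haar k))) =
        (\<Sum>k\<in>M. (if k = m then pair (haar_fun m) (T (haar m)) else 0) + signum_of X m * signum_of X k * x m k)"
      unfolding sum_distrib_left by (intro sum.cong refl) (auto simp: x_def signum_of_def)
    then show "signum_of X m * (\<Sum>k\<in>M. signum_of X k * pair (haar_fun m) (T (haar k))) =
        pair (haar_fun m) (T (haar m)) + (\<Sum>k\<in>M. signum_of X m * signum_of X k * x m k)"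
      using m fin by (simp add: sum.distrib)
  qed
  also have "\<dots> = (\<Sum>m\<in>M. pair (haar_fun m) (T (haar m))) + Q"
    by (simp add: sum.distrib Q_def)
  finally have eq: "pair (block M X) (T (L1_class (block M X))) = (\<Sum>m\<in>M. pair (haar_fun m) (T (haar m))) + Q" .
  have "\<bar>\<Sum>m\<in>M. pair (haar_fun m) (T (haar m))\<bar> \<le> (\<Sum>m\<in>M. \<bar>pair (haar_fun m) (T (haar m))\<bar>)" by (rule sum_abs)
  also have "\<dots> \<le> (\<Sum>m\<in>{N..<2 * N}. \<bar>pair (haar_fun m) (T (haar m))\<bar>)" using M by (intro sum_mono2) auto
  finally have "\<bar>pair (block M X) (T (L1_class (block M X)))\<bar> \<le> \<theta>" using eq Nd Q_le by linarith
  moreover have "\<forall>g\<in>G. \<bar>pair g (T (L1_class (block M X)))\<bar> \<le> \<theta>"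
    using L_le G(2) by (simp add: pair_T L_def y_def)
  moreover have "\<forall>F\<in>H. \<bar>pair (block M X) F\<bar> \<le> \<theta>"
    using pair_block_le[OF N1 M(1)] NH by (meson less_imp_le order_trans)
  ultimately show ?thesis using Nn N1 M by blast
qed

end

section \<open>A tree of almost independent blocks\<close>

text \<open>The tree is read off the blocks: \<open>b n\<close> is \<open>1\<close> on the left child of node \<open>n\<close> and \<open>- 1\<close> on the right
  child, and \<open>b 0\<close> is \<open>1\<close> on the root. Node \<open>n \<ge> 1\<close> depends only on a block with a smaller index,
  which makes the recursive choice of the blocks possible.\<close>

definition node :: "(nat \<Rightarrow> real \<Rightarrow> real) \<Rightarrow> nat \<Rightarrow> real set"
  where "node b n = {x. b (n div 2) x = (if n = 1 \<or> even n then 1 else - 1)}"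

lemma node_cong: "b (n div 2) = b' (n div 2) \<Longrightarrow> node b n = node b' n"
  by (simp add: node_def)

lemma node_root: "node b 1 = {x. b 0 x = 1}"
  and node_children: "n \<ge> 1 \<Longrightarrow> node b (2 * n) = {x. b n x = 1}"
    "n \<ge> 1 \<Longrightarrow> node b (2 * n + 1) = {x. b n x = - 1}"
  by (auto simp: node_def)

context
  fixes b :: "nat \<Rightarrow> real \<Rightarrow> real" and p :: nat
  assumes p: "p \<ge> 1" and b0: "b 0 = indicator (dyad p)"
    and b: "\<forall>n\<ge>1. \<exists>N M X. N \<ge> n \<and> N \<ge> 1 \<and> M \<subseteq> {N..<2 * N} \<and> b n = block M X \<and>
      node b n = (\<Union>m\<in>M. dyad m)"
begin

lemma node_dyadic:
  assumes "n \<ge> 1"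
  shows "\<exists>N M. N \<ge> 1 \<and> M \<subseteq> {N..<2 * N} \<and> node b n = (\<Union>m\<in>M. dyad m)"
  using b[rule_format, OF assms] by blast

lemma b_cases:
  assumes n: "n \<ge> 1"
  shows "b n x \<in> {- 1, 0, 1}" "b n x \<noteq> 0 \<longleftrightarrow> x \<in> node b n"
proof -
  obtain N M X where *: "N \<ge> 1" "M \<subseteq> {N..<2 * N}" "b n = block M X" "node b n = (\<Union>m\<in>M. dyad m)"
    using b[rule_format, OF n] by blast
  show "b n x \<in> {- 1, 0, 1}" "b n x \<noteq> 0 \<longleftrightarrow> x \<in> node b n"
    using block_values[OF *(1,2), of X x] block_nonzero[OF *(1,2), of X x] *(3,4) by auto
qed

lemma node_sets:
  assumes "n \<ge> 1"
  shows "node b n \<in> sets unit_leb"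
proof -
  obtain N M where M: "N \<ge> 1" "M \<subseteq> {N..<2 * N}" "node b n = (\<Union>m\<in>M. dyad m)"
    using node_dyadic[OF assms] by blast
  have "finite M" using M(2) finite_subset by blast
  then show ?thesis unfolding M(3) using M(1,2) by (intro sets.finite_UN dyad.sets_tree) auto
qed

lemma root_eq: "node b 1 = dyad p"
  by (simp add: node_root[simplified] b0 indicator_eq_1_iff)

lemma b_eq:
  assumes n: "n \<ge> 1"
  shows "b n = (\<lambda>x. indicator (node b (2 * n)) x - indicator (node b (2 * n + 1)) x)"
proof
  fix x show "b n x = indicator (node b (2 * n)) x - indicator (node b (2 * n + 1)) x"
    unfolding node_children[OF n] using b_cases(1)[OF n, of x] by (auto simp: indicator_def)
qed

text \<open>Block \<open>n\<close> consists of Haar functions with index at least \<open>n\<close>. This gives the convergence of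
  transfer sums out of the new tree.\<close>

lemma b_vanish:
  assumes "1 \<le> j" "j \<le> n"
  shows "pair (b n) (ind (dyad j)) = 0"
proof -
  obtain N M X where *: "N \<ge> n" "N \<ge> 1" "M \<subseteq> {N..<2 * N}" "b n = block M X"
    using b[rule_format, of n] assms by auto
  then show ?thesis using pair_block_dyad[of N M j X] assms by simp
qed

lemma halving_tree_node: "halving_tree (node b)"
proof
  fix n :: nat assume n: "n \<ge> 1"
  show "node b n \<in> sets unit_leb" using n by (rule node_sets)
  show "node b n = node b (2 * n) \<union> node b (2 * n + 1)"
  proof -
    have "x \<in> node b n \<longleftrightarrow> b n x = 1 \<or> b n x = - 1" for x using b_cases[OF n, of x] by auto
    then show ?thesis unfolding node_children[OF n] by auto
  qed
  show "node b (2 * n) \<inter> node b (2 * n + 1) = {}"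
    unfolding node_children[OF n] by auto
  have s: "node b (2 * n) \<in> sets unit_leb" "node b (2 * n + 1) \<in> sets unit_leb"
    using n by (intro node_sets; simp)+
  have "pair (b n) (ind (dyad 1)) = 0" using n by (intro b_vanish) auto
  then have "pair (indicator (node b (2 * n))) (ind (dyad 1)) = pair (indicator (node b (2 * n + 1))) (ind (dyad 1))"
    unfolding b_eq[OF n] using s by (subst (asm) pair_diff) (auto intro: test_indicator)
  moreover have "node b k \<inter> dyad 1 = node b k" if "k \<ge> 1" for k
  proof -
    obtain N M where M: "N \<ge> 1" "M \<subseteq> {N..<2 * N}" "node b k = (\<Union>m\<in>M. dyad m)"
      using node_dyadic[OF \<open>k \<ge> 1\<close>] by blast
    have "dyad m \<subseteq> dyad 1" if "m \<in> M" for m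
      using dyad_bounds[of m] dyad_eq[of m] M that by (auto simp: dyad_1)
    then show ?thesis using M(3) by blast
  qed
  ultimately show "measure unit_leb (node b (2 * n)) = measure unit_leb (node b (2 * n + 1))"
    using s n by (simp add: pair_ind dyad.sets_tree)
next
  show "measure unit_leb (node b 1) > 0"
    unfolding root_eq using p by (simp add: measure_dyad)
qed

lemma haar_of_node: "halving_tree.haar_of (node b) n = b n"
proof (cases "n = 0")
  case True
  then show ?thesis using halving_tree.haar_of_def[OF halving_tree_node] root_eq b0 by auto
next
  case False
  then have "n \<ge> 1" by simp
  then show ?thesis using halving_tree.haar_of_def[OF halving_tree_node] b_eq[of n] False by auto
qed

end

context L1_operator
begin

text \<open>The root is a dyadic interval \<open>D\<close> for which \<open>\<langle>1_D, T 1_D\<rangle>\<close> is small relative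
  to its length; one exists because these pairings add up to little over a late partition, while
  the lengths add up to 1. The blocks are then chosen one after the other, each against all earlier
  ones.\<close>

lemma exists_small_tree:
  assumes zero: "diag_lim = 0" and \<eta>: "\<eta> > 0"
  obtains A where "halving_tree A"
    and "\<And>j n. 1 \<le> j \<Longrightarrow> j \<le> n \<Longrightarrow> pair (halving_tree.haar_of A n) (ind (dyad j)) = 0"
    and "\<And>m n. \<bar>pair (halving_tree.haar_of A m) (T (L1_class (halving_tree.haar_of A n)))\<bar>
      \<le> \<eta> * measure unit_leb (A 1) * (1 / 8) ^ max m n"
proof -
  have "\<exists>p\<ge>1. \<bar>pair (indicator (dyad p)) (T (ind (dyad p)))\<bar> \<le> \<eta> * weight p"
  proof -
    have "\<forall>\<^sub>F N in sequentially. (\<Sum>m\<in>{N..<2 * N}. \<bar>pair (indicator (dyad m)) (T (ind (dyad m)))\<bar>) < \<eta>"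
      using small_diag(1)[OF zero] \<eta> by (intro order_tendstoD) auto
    moreover have "\<forall>\<^sub>F N in sequentially. N \<ge> (1::nat)" by (rule eventually_ge_at_top)
    ultimately have "\<forall>\<^sub>F N in sequentially. N \<ge> 1 \<and>
        (\<Sum>m\<in>{N..<2 * N}. \<bar>pair (indicator (dyad m)) (T (ind (dyad m)))\<bar>) < \<eta>"
      by eventually_elim auto
    from eventually_happens'[OF sequentially_bot this]
    obtain N where N: "N \<ge> 1" "(\<Sum>m\<in>{N..<2 * N}. \<bar>pair (indicator (dyad m)) (T (ind (dyad m)))\<bar>) < \<eta>"
      by blast
    have "\<exists>m\<in>{N..<2 * N}. \<bar>pair (indicator (dyad m)) (T (ind (dyad m)))\<bar> \<le> \<eta> * weight m"
    proof (rule ccontr)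
      assume "\<not> ?thesis"
      then have "(\<Sum>m\<in>{N..<2 * N}. \<eta> * weight m) \<le> (\<Sum>m\<in>{N..<2 * N}. \<bar>pair (indicator (dyad m)) (T (ind (dyad m)))\<bar>)"
        by (intro sum_mono) (auto simp: not_le intro: less_imp_le)
      then show False using N sum_weight_level[OF N(1)] by (simp add: sum_distrib_left[symmetric])
    qed
    then show ?thesis using N(1) by (meson atLeastLessThan_iff order_trans)
  qed
  then obtain p where p: "p \<ge> 1" "\<bar>pair (indicator (dyad p)) (T (ind (dyad p)))\<bar> \<le> \<eta> * weight p" by blast
  \<comment> \<open>The rate 8 makes the bound at most a multiple of \<open>1 / (4 ^ n * 2 ^ m)\<close> for the pair \<open>m, n\<close>.\<close>
  define \<theta> where "\<theta> n = \<eta> * weight p * (1 / 8) ^ n" for n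
  have \<theta>_pos: "\<theta> n > 0" for n using \<eta> by (simp add: \<theta>_def)
  \<comment> \<open>Block \<open>0\<close> is the indicator of the root; block \<open>n\<close> lives on node \<open>n\<close> and starts at index \<open>n\<close> or later.\<close>
  define shape where "shape b n r \<longleftrightarrow> (if n = 0 then r = indicator (dyad p) else
      \<exists>N M X. N \<ge> n \<and> N \<ge> 1 \<and> M \<subseteq> {N..<2 * N} \<and> r = block M X \<and> node b n = (\<Union>m\<in>M. dyad m))"
    for b :: "nat \<Rightarrow> real \<Rightarrow> real" and n r
  \<comment> \<open>Only the blocks \<open>b m\<close> with \<open>m < n\<close> enter, as a recursive choice requires.\<close>
  define P where "P b n r \<longleftrightarrow> shape b n r \<and> \<bar>pair r (T (L1_class r))\<bar> \<le> \<theta> n \<and>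
      (\<forall>m<n. \<bar>pair (b m) (T (L1_class r))\<bar> \<le> \<theta> n \<and> \<bar>pair r (T (L1_class (b m)))\<bar> \<le> \<theta> n)"
    for b :: "nat \<Rightarrow> real \<Rightarrow> real" and n r
  have "\<exists>b. \<forall>n. P b n (b n)"
  proof (rule dependent_wellorder_choice)
    fix r and f g :: "nat \<Rightarrow> real \<Rightarrow> real" and n :: nat
    assume eq: "\<And>m. m < n \<Longrightarrow> f m = g m"
    have "shape f n r = shape g n r"
    proof (cases "n = 0")
      case False
      then have "node f n = node g n" using eq[of "n div 2"] by (intro node_cong) auto
      then show ?thesis by (simp add: shape_def)
    qed (simp add: shape_def)
    then show "P f n r = P g n r" using eq by (simp add: P_def)
  next
    fix n :: nat and b :: "nat \<Rightarrow> real \<Rightarrow> real"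
    assume IH: "\<And>m. m < n \<Longrightarrow> P b m (b m)"
    have shape: "shape b m (b m)" if "m < n" for m using IH[OF that] by (simp add: P_def)
    show "\<exists>r. P b n r"
    proof (cases "n = 0")
      case True
      have "P b 0 (indicator (dyad p))"
        using p by (simp add: P_def shape_def \<theta>_def ind_def)
      then show ?thesis using True by blast
    next
      case False
      have test_b: "test_fun (b m)" if m: "m < n" for m
      proof (cases "m = 0")
        case True
        then show ?thesis using shape[OF m] p(1) by (simp add: shape_def test_dyad)
      next
        case False
        then obtain N M X where "N \<ge> 1" "M \<subseteq> {N..<2 * N}" "b m = block M X"
          using shape[OF m] by (auto simp: shape_def)
        then show ?thesis using test_block[of N M X] by simp
      qed
      have "\<exists>N M. N \<ge> 1 \<and> M \<subseteq> {N..<2 * N} \<and> node b n = (\<Union>m\<in>M. dyad m)"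
      proof (cases "n div 2 = 0")
        case True
        then have "n = 1" using False by linarith
        then have "node b n = dyad p"
          using shape[of 0] by (simp add: node_root[simplified] shape_def indicator_eq_1_iff)
        then show ?thesis using p(1) by (intro exI[of _ p] exI[of _ "{p}"]) auto
      next
        case half: False
        have "n div 2 < n" using False by simp
        from shape[OF this] half obtain N M X where
          *: "N \<ge> 1" "M \<subseteq> {N..<2 * N}" "b (n div 2) = block M X"
          by (auto simp: shape_def)
        define s :: real where "s = (if n = 1 \<or> even n then 1 else - 1)"
        have "\<exists>M'\<subseteq>{2 * N..<2 * (2 * N)}. {x. block M X x = s} = (\<Union>m\<in>M'. dyad m)"
          by (rule block_level_set[OF *(1,2)]) (simp add: s_def)
        then show ?thesis using * by (intro exI[of _ "2 * N"]) (auto simp: node_def s_def)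
      qed
      then obtain N0 M0 where M0: "N0 \<ge> 1" "M0 \<subseteq> {N0..<2 * N0}" "node b n = (\<Union>m\<in>M0. dyad m)"
        by blast
      let ?G = "b ` {..<n}" and ?H = "(\<lambda>m. T (L1_class (b m))) ` {..<n}"
      have "\<exists>N M X. N \<ge> n \<and> N \<ge> 1 \<and> M \<subseteq> {N..<2 * N} \<and> (\<Union>m\<in>M0. dyad m) = (\<Union>m\<in>M. dyad m) \<and>
          \<bar>pair (block M X) (T (L1_class (block M X)))\<bar> \<le> \<theta> n \<and>
          (\<forall>g\<in>?G. \<bar>pair g (T (L1_class (block M X)))\<bar> \<le> \<theta> n) \<and>
          (\<forall>F\<in>?H. \<bar>pair (block M X) F\<bar> \<le> \<theta> n)"
        by (rule exists_small_block[OF zero M0(1,2)]) (use test_b \<theta>_pos in auto)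
      then obtain N M X where r: "N \<ge> n" "N \<ge> 1" "M \<subseteq> {N..<2 * N}" "(\<Union>m\<in>M0. dyad m) = (\<Union>m\<in>M. dyad m)"
        "\<bar>pair (block M X) (T (L1_class (block M X)))\<bar> \<le> \<theta> n"
        "\<forall>g\<in>?G. \<bar>pair g (T (L1_class (block M X)))\<bar> \<le> \<theta> n"
        "\<forall>F\<in>?H. \<bar>pair (block M X) F\<bar> \<le> \<theta> n"
        by (elim exE conjE)
      have "shape b n (block M X)"
        unfolding shape_def using False M0(3) r(1-4) by (simp only: if_False) metis
      then have "P b n (block M X)"
        unfolding P_def using r(5-7) by blast
      then show ?thesis by blast
    qed
  qed
  then obtain b where b: "\<And>n. P b n (b n)" by blast
  have b0: "b 0 = indicator (dyad p)" using b[of 0] by (simp add: P_def shape_def)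
  have b1: "\<forall>n\<ge>1. \<exists>N M X. N \<ge> n \<and> N \<ge> 1 \<and> M \<subseteq> {N..<2 * N} \<and> b n = block M X \<and>
      node b n = (\<Union>m\<in>M. dyad m)"
  proof (intro allI impI)
    fix n :: nat assume "n \<ge> 1"
    then show "\<exists>N M X. N \<ge> n \<and> N \<ge> 1 \<and> M \<subseteq> {N..<2 * N} \<and> b n = block M X \<and>
        node b n = (\<Union>m\<in>M. dyad m)"
      using b[of n] by (simp add: P_def shape_def)
  qed
  note facts = p(1) b0 b1
  show thesis
  proof (rule that)
    show "halving_tree (node b)" by (rule halving_tree_node[OF facts])
    show "pair (halving_tree.haar_of (node b) n) (ind (dyad j)) = 0" if "1 \<le> j" "j \<le> n" for j n
      unfolding haar_of_node[OF facts] using that by (rule b_vanish[OF facts])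
    have mass: "measure unit_leb (node b 1) = weight p"
      unfolding root_eq[OF facts] using p(1) by (rule measure_dyad)
    show "\<bar>pair (halving_tree.haar_of (node b) m) (T (L1_class (halving_tree.haar_of (node b) n)))\<bar>
        \<le> \<eta> * measure unit_leb (node b 1) * (1 / 8) ^ max m n" for m n
      unfolding haar_of_node[OF facts] mass \<theta>_def[symmetric]
      using b[of m] b[of n] by (cases m n rule: linorder_cases) (auto simp: P_def max_def)
  qed
qed

end

section \<open>Factoring the identity\<close>

text \<open>Surjectivity is the contraction principle for \<open>x \<mapsto> y - Q x\<close>; the lower bound
  \<open>(1 - \<eta>) \<parallel>x\<parallel> \<le> \<parallel>x + Q x\<parallel>\<close> gives the rest.\<close>

lemma small_perturbation_invertible:
  fixes Q :: "'a::banach \<Rightarrow> 'a"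
  assumes Q: "bounded_linear Q" and le: "\<And>x. norm (Q x) \<le> \<eta> * norm x" and \<eta>: "0 \<le> \<eta>" "\<eta> < 1"
  obtains W where "bounded_linear W" "\<And>x. W (x + Q x) = x" "onorm W \<le> 1 / (1 - \<eta>)"
proof -
  define U where "U x = x + Q x" for x
  have linU: "linear U"
    unfolding U_def using bounded_linear.linear[OF Q]
    by (intro linearI) (auto simp: linear_add linear_scale algebra_simps)
  have lower: "(1 - \<eta>) * norm x \<le> norm (U x)" for x
    using norm_triangle_ineq2[of x "- Q x"] le[of x] by (simp add: U_def algebra_simps)
  have inj: "inj U"
  proof (rule linear_injective_0[OF linU, THEN iffD2], intro allI impI)
    fix x assume "U x = 0"
    then show "x = 0" using lower[of x] \<eta> by (simp add: mult_le_0_iff)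
  qed
  have surj: "surj U"
    unfolding surj_def
  proof
    fix y
    have "\<exists>!x. y - Q x = x"
    proof (rule banach_fix_type[OF \<eta>], intro allI)
      fix x z show "dist (y - Q x) (y - Q z) \<le> \<eta> * dist x z"
        using le[of "z - x"] by (simp add: dist_norm linear_diff[OF bounded_linear.linear[OF Q]] norm_minus_commute)
    qed
    then obtain x where "y - Q x = x" by blast
    then have "U x = y" unfolding U_def by (metis diff_add_cancel)
    then show "\<exists>x. y = U x" by blast
  qed
  define W where "W = inv U"
  have UW: "U (W y) = y" for y unfolding W_def by (rule surj_f_inv_f[OF surj])
  have WU: "W (U x) = x" for x unfolding W_def by (rule inv_f_f[OF inj])
  have W_le: "norm (W y) \<le> (1 / (1 - \<eta>)) * norm y" for y
    using lower[of "W y"] \<eta> by (simp add: UW field_simps)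
  have "bounded_linear W"
  proof (rule bounded_linear_intro[where K = "1 / (1 - \<eta>)"])
    fix x y :: 'a and r :: real
    show "W (x + y) = W x + W y" using WU[of "W x + W y"] by (simp add: linear_add[OF linU] UW)
    show "W (r *\<^sub>R x) = r *\<^sub>R W x" using WU[of "r *\<^sub>R W x"] by (simp add: linear_scale[OF linU] UW)
    show "norm (W x) \<le> norm x * (1 / (1 - \<eta>))" using W_le[of x] by (simp add: mult.commute)
  qed
  moreover have "onorm W \<le> 1 / (1 - \<eta>)" using W_le \<eta> by (intro onorm_bound) auto
  ultimately show thesis using WU that by (simp add: U_def)
qed

context L1_operator
begin

text \<open>\<open>R\<close> carries the Haar functions to the blocks and \<open>S\<close> averages back along the tree of blocks. The
  Haar coefficients of \<open>F\<close> can grow like \<open>2 ^ n\<close> relative to its norm; the decay of the matrix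
  entries in both indices absorbs this and leaves two geometric series.\<close>

lemma compression_small:
  assumes zero: "diag_lim = 0" and \<eta>: "\<eta> > 0"
  shows "\<exists>R S :: L1 \<Rightarrow> L1. bounded_linear R \<and> bounded_linear S \<and> onorm R \<le> 1 \<and> onorm S \<le> 1 \<and>
    (\<forall>F. S (R F) = F) \<and> (\<forall>F. norm (S (T (R F))) \<le> \<eta> * norm F)"
proof -
  obtain A where A: "halving_tree A"
    and van: "\<And>j n. 1 \<le> j \<Longrightarrow> j \<le> n \<Longrightarrow> pair (halving_tree.haar_of A n) (ind (dyad j)) = 0"
    and small: "\<And>m n. \<bar>pair (halving_tree.haar_of A m) (T (L1_class (halving_tree.haar_of A n)))\<bar>
      \<le> \<eta> / 4 * measure unit_leb (A 1) * (1 / 8) ^ max m n"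
    using exists_small_tree[OF zero, of "\<eta> / 4"] \<eta> by auto
  interpret A: halving_tree A by fact
  interpret R: tree_transfer dyad A
    by unfold_locales (rule pair_haar_of_dyad_vanish)
  interpret S: tree_transfer A dyad
    by unfold_locales (auto intro!: eventually_sequentiallyI van)
  have d1: "measure unit_leb (dyad (Suc 0)) = 1" using measure_dyad[of 1] by simp
  define h where "h n = L1_class (A.haar_of n)" for n
  have Rh: "R.transfer (haar n) = (1 / A.mass) *\<^sub>R h n" for n
    using R.transfer_haar_of[of n] by (simp add: haar_eq d1 h_def)
  have Sh: "S.transfer (h n) = A.mass *\<^sub>R haar n" for n
    using S.transfer_haar_of[of n] by (simp add: haar_eq d1 h_def)
  have mass: "A.mass > 0" by (rule A.root_pos)
  define c where "c F n = pair (haar_fun n) F / weight n" for F n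
  have c_le: "\<bar>c F n\<bar> \<le> 2 ^ n * norm F" for F n
  proof -
    have "\<bar>c F n\<bar> \<le> norm F / weight n"
      unfolding c_def using pair_le[OF test_haar_fun, of n F] by (simp add: divide_right_mono less_imp_le)
    also have "\<dots> \<le> norm F / (1 / 2 ^ n)"
      using weight_ge[of n] by (intro divide_left_mono) auto
    finally show ?thesis by (simp add: mult.commute)
  qed
  have exp: "(\<lambda>n. c F n *\<^sub>R haar n) sums F" for F
    using haar_expansion[of F] by (simp add: c_def)
  have SR: "S.transfer (R.transfer F) = F" for F
  proof -
    have comp: "bounded_linear (\<lambda>F. S.transfer (R.transfer F))"
      by (rule bounded_linear_compose[OF S.bounded_linear_transfer R.bounded_linear_transfer])
    have "(\<lambda>n. S.transfer (R.transfer (c F n *\<^sub>R haar n))) sums S.transfer (R.transfer F)"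
      by (rule bounded_linear.sums[OF comp exp])
    moreover have "S.transfer (R.transfer (c F n *\<^sub>R haar n)) = c F n *\<^sub>R haar n" for n
      using mass bounded_linear.linear[OF S.bounded_linear_transfer] bounded_linear.linear[OF R.bounded_linear_transfer]
      by (simp add: linear_scale Rh Sh)
    ultimately have "(\<lambda>n. c F n *\<^sub>R haar n) sums S.transfer (R.transfer F)" by simp
    then show ?thesis by (rule sums_unique2[OF _ exp])
  qed
  have Sb: "norm (S.transfer (T (h n))) \<le> \<eta> / 2 * A.mass * (1 / 4) ^ n" for n
  proof -
    have expansion: "(\<lambda>m. (pair (A.haar_of m) (T (h n)) / weight m) *\<^sub>R haar m) sums S.transfer (T (h n))"
      using S.transfer_sums[of "T (h n)"] by (simp add: haar_eq d1)
    have le: "norm ((pair (A.haar_of m) (T (h n)) / weight m) *\<^sub>R haar m) \<le>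
        (\<eta> / 4 * A.mass * (1 / 4) ^ n) * (1 / 2) ^ m" for m
    proof -
      have "norm ((pair (A.haar_of m) (T (h n)) / weight m) *\<^sub>R haar m) = \<bar>pair (A.haar_of m) (T (h n))\<bar>"
        by (simp add: norm_haar_weight)
      also have "\<dots> \<le> \<eta> / 4 * A.mass * (1 / 8) ^ max m n" using small by (simp add: h_def)
      also have "\<dots> \<le> \<eta> / 4 * A.mass * ((1 / 4) ^ n * (1 / 2) ^ m)"
      proof (rule mult_left_mono)
        have "(1 / 8 :: real) ^ max m n = (1 / 4) ^ max m n * (1 / 2) ^ max m n"
          by (simp add: power_mult_distrib[symmetric])
        also have "\<dots> \<le> (1 / 4) ^ n * (1 / 2) ^ m"
          by (intro mult_mono power_decreasing) auto
        finally show "(1 / 8 :: real) ^ max m n \<le> (1 / 4) ^ n * (1 / 2) ^ m" .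
      qed (use \<eta> mass in auto)
      finally show ?thesis by simp
    qed
    have "(\<lambda>m. (\<eta> / 4 * A.mass * (1 / 4) ^ n) * (1 / 2) ^ m) sums ((\<eta> / 4 * A.mass * (1 / 4) ^ n) * 2)"
      using geometric_sums[of "1 / 2 :: real"] by (intro sums_mult) simp
    from norm_sums_le[OF expansion this le] have "norm (S.transfer (T (h n))) \<le> (\<eta> / 4 * A.mass * (1 / 4) ^ n) * 2" .
    then show ?thesis by (simp add: mult_ac)
  qed
  have QF: "norm (S.transfer (T (R.transfer F))) \<le> \<eta> * norm F" for F
  proof -
    have comp: "bounded_linear (\<lambda>F. S.transfer (T (R.transfer F)))"
      by (rule bounded_linear_compose[OF S.bounded_linear_transfer
            bounded_linear_compose[OF bounded_linear_T R.bounded_linear_transfer]])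
    have expansion: "(\<lambda>n. S.transfer (T (R.transfer (c F n *\<^sub>R haar n)))) sums S.transfer (T (R.transfer F))"
      by (rule bounded_linear.sums[OF comp exp])
    have le: "norm (S.transfer (T (R.transfer (c F n *\<^sub>R haar n)))) \<le> (\<eta> / 2 * norm F) * (1 / 2) ^ n" for n
    proof -
      have "S.transfer (T (R.transfer (c F n *\<^sub>R haar n))) = (c F n / A.mass) *\<^sub>R S.transfer (T (h n))"
        using S.bounded_linear_transfer R.bounded_linear_transfer bounded_linear_T
        by (simp add: linear_scale[OF bounded_linear.linear] Rh)
      then have "norm (S.transfer (T (R.transfer (c F n *\<^sub>R haar n)))) = \<bar>c F n\<bar> / A.mass * norm (S.transfer (T (h n)))"
        using mass by simp
      also have "\<dots> \<le> (2 ^ n * norm F) / A.mass * (\<eta> / 2 * A.mass * (1 / 4) ^ n)"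
        using mass \<eta> by (intro mult_mono divide_right_mono c_le Sb) auto
      also have "\<dots> = (\<eta> / 2 * norm F) * (2 ^ n * (1 / 4) ^ n)" using mass by simp
      also have "(2 :: real) ^ n * (1 / 4) ^ n = (1 / 2) ^ n" by (simp add: power_mult_distrib[symmetric])
      finally show ?thesis .
    qed
    have "(\<lambda>n. (\<eta> / 2 * norm F) * (1 / 2) ^ n) sums ((\<eta> / 2 * norm F) * 2)"
      using geometric_sums[of "1 / 2 :: real"] by (intro sums_mult) simp
    from norm_sums_le[OF expansion this le] have "norm (S.transfer (T (R.transfer F))) \<le> (\<eta> / 2 * norm F) * 2" .
    then show ?thesis by simp
  qed
  have "onorm R.transfer \<le> 1" "onorm S.transfer \<le> 1"
    by (auto intro!: onorm_bound simp: R.norm_transfer_le S.norm_transfer_le)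
  then show ?thesis
    using R.bounded_linear_transfer S.bounded_linear_transfer SR QF
    by (intro exI[of _ R.transfer] exI[of _ S.transfer]) simp
qed

end

text \<open>Multiplication by \<open>1 / a\<close> with \<open>a\<close> the diagonal part of \<open>T\<close> accounts for the factor \<open>1 / \<delta>\<close>. The
  isometry into the copy of \<open>L1\<close>, the averaging back and the final inverse have norm at most 1 or
  arbitrarily close to 1.\<close>

lemma factor_of_diag:
  assumes T: "bounded_linear T" and \<delta>: "\<delta> > 0" and \<epsilon>: "\<epsilon> > 0"
    and d: "\<And>n. n \<ge> 1 \<Longrightarrow> \<bar>pair (haar_fun n) (T (haar n))\<bar> \<ge> \<delta> * weight n"
  shows "identity_factors (1 / \<delta> + \<epsilon>) T"
proof -
  interpret T: L1_operator T by (rule L1_operator.intro[OF T])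
  define \<alpha> where "\<alpha> = rep_L1 T.diag_lim"
  have [measurable]: "\<alpha> \<in> borel_measurable unit_leb" by (simp add: \<alpha>_def)
  \<comment> \<open>A representative of \<open>1 / a\<close> that is bounded at every point.\<close>
  define g where "g x = (if \<bar>\<alpha> x\<bar> \<ge> \<delta> then 1 / \<alpha> x else 0)" for x
  have g_meas: "g \<in> borel_measurable unit_leb" unfolding g_def by measurable
  have g_le: "\<bar>g x\<bar> \<le> 1 / \<delta>" for x
    using \<delta> by (auto simp: g_def abs_divide intro!: divide_left_mono)
  note G = bounded_linear_mulop[OF g_meas g_le]
  have ga: "mulop g T.diag_lim = ind (dyad 1)"
    unfolding mulop_def ind_def
  proof (rule L1_class_eqI)
    show "integrable unit_leb (\<lambda>x. g x * rep_L1 T.diag_lim x)"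
      by (rule integrable_mult_bounded[OF _ g_meas g_le]) simp
    show "integrable unit_leb (indicator (dyad 1) :: real \<Rightarrow> real)"
      by (intro integrable_indicator_unit dyad.sets_tree) simp
    have "{1::real} \<in> null_sets unit_leb" by (auto simp: null_sets_restrict_space)
    note not_1 = AE_not_in[OF this]
    have "AE x in unit_leb. \<bar>rep_L1 T.diag_lim x\<bar> \<ge> \<delta>"
      by (rule T.diag_lim_ge) (rule d)
    with not_1 AE_space
    show "AE x in unit_leb. g x * rep_L1 T.diag_lim x = indicator (dyad 1) x"
    proof eventually_elim
      case (elim x)
      then have "x \<in> dyad 1" by (auto simp: dyad_1 space_restrict_space)
      then show ?case using elim \<delta> by (auto simp: g_def \<alpha>_def)
    qed
  qed
  define X where "X F = mulop g (T F) - F" for F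
  have blX: "bounded_linear X"
    unfolding X_def by (intro bounded_linear_sub bounded_linear_compose[OF G(1) T] bounded_linear_ident)
  interpret X: L1_operator X by (rule L1_operator.intro[OF blX])
  have zero: "X.diag_lim = 0"
  proof -
    have "X.diag_part N = mulop g (T.diag_part N) - ind (dyad 1)" if N: "N \<ge> 1" for N
    proof -
      have "mulop (indicator (dyad m)) (X (ind (dyad m))) =
          mulop g (mulop (indicator (dyad m)) (T (ind (dyad m)))) - ind (dyad m)" if m: "m \<ge> 1" for m
      proof -
        have t: "test_fun (indicator (dyad m))" by (rule test_dyad[OF m])
        have "mulop (indicator (dyad m)) (mulop g F) = mulop g (mulop (indicator (dyad m)) F)" for F
        proof -
          have "mulop (indicator (dyad m)) (mulop g F) = L1_class (\<lambda>x. indicator (dyad m) x * (g x * rep_L1 F x))"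
            unfolding mulop_def[of g] using t g_meas g_le
            by (subst mulop_class[where c = 1]) (auto simp: test_fun_def intro!: integrable_mult_bounded[where c = "1 / \<delta>"])
          also have "\<dots> = L1_class (\<lambda>x. g x * (indicator (dyad m) x * rep_L1 F x))" by (simp add: algebra_simps)
          also have "\<dots> = mulop g (mulop (indicator (dyad m)) F)"
            unfolding mulop_def[of "indicator _"] using t g_meas g_le
            by (subst mulop_class[where c = "1 / \<delta>"]) (auto intro!: test_integrable)
          finally show ?thesis .
        qed
        moreover have "mulop (indicator (dyad m)) (ind (dyad m)) = ind (dyad m)"
          unfolding ind_def using t
          by (subst mulop_class[where c = 1])
            (auto simp: test_fun_def indicator_def intro!: arg_cong[where f = L1_class] integrable_indicator_unit dyad.sets_tree[OF m])
        ultimately show ?thesis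
          using linear_diff[OF bounded_linear.linear[OF linear_mulop[OF t]]] by (simp add: X_def)
      qed
      then have "X.diag_part N = (\<Sum>m\<in>{N..<2 * N}. mulop g (mulop (indicator (dyad m)) (T (ind (dyad m)))) - ind (dyad m))"
        unfolding X.diag_part_def using N by (intro sum.cong) auto
      also have "\<dots> = mulop g (T.diag_part N) - (\<Sum>m\<in>{N..<2 * N}. ind (dyad m))"
        by (simp add: sum_subtractf T.diag_part_def linear_sum[OF bounded_linear.linear[OF G(1)]])
      also have "(\<Sum>m\<in>{N..<2 * N}. ind (dyad m)) = ind (dyad 1)"
        using N by (intro ind_eq_sum[symmetric]) (auto simp: dyad.indicator_level intro!: dyad.sets_tree)
      finally show ?thesis .
    qed
    then have "\<forall>\<^sub>F N in sequentially. mulop g (T.diag_part N) - ind (dyad 1) = X.diag_part N"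
      by (intro eventually_sequentiallyI[of 1]) simp
    moreover have "(\<lambda>N. mulop g (T.diag_part N) - ind (dyad 1)) \<longlonglongrightarrow> mulop g T.diag_lim - ind (dyad 1)"
      by (intro tendsto_diff tendsto_const bounded_linear.tendsto[OF G(1)] T.diag_part_LIMSEQ)
    ultimately have "X.diag_part \<longlonglongrightarrow> 0"
      unfolding ga by (auto intro: Lim_transform_eventually)
    then show ?thesis using X.diag_part_LIMSEQ LIMSEQ_unique by blast
  qed
  \<comment> \<open>Chosen so that \<open>1 / (1 - \<eta>) = 1 + \<delta> * \<epsilon>\<close>, which times \<open>1 / \<delta>\<close> is \<open>1 / \<delta> + \<epsilon>\<close>.\<close>
  define \<eta> where "\<eta> = \<delta> * \<epsilon> / (1 + \<delta> * \<epsilon>)"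
  have \<eta>: "\<eta> > 0" "\<eta> < 1" using \<delta> \<epsilon> by (auto simp: \<eta>_def field_simps add_pos_pos)
  have \<eta>_eq: "1 / (1 - \<eta>) = 1 + \<delta> * \<epsilon>"
  proof -
    have "1 + \<delta> * \<epsilon> > 0" using \<delta> \<epsilon> by (simp add: add_pos_pos)
    then have "1 - \<eta> = 1 / (1 + \<delta> * \<epsilon>)" by (simp add: \<eta>_def field_simps)
    then show ?thesis by simp
  qed
  obtain R S :: "L1 \<Rightarrow> L1" where R: "bounded_linear R" and S: "bounded_linear S"
    and R_le: "onorm R \<le> 1" and S_le: "onorm S \<le> 1"
    and SR: "\<And>F. S (R F) = F" and small: "\<And>F. norm (S (X (R F))) \<le> \<eta> * norm F"
    using X.compression_small[OF zero \<eta>(1)] by (elim exE conjE) blast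
  have blQ: "bounded_linear (\<lambda>F. S (X (R F)))"
    by (intro bounded_linear_compose[OF S] bounded_linear_compose[OF blX R])
  obtain W where W: "bounded_linear W" "\<And>F. W (F + S (X (R F))) = F" "onorm W \<le> 1 / (1 - \<eta>)"
    using small_perturbation_invertible[where Q = "\<lambda>F. S (X (R F))", OF blQ small less_imp_le[OF \<eta>(1)] \<eta>(2)]
    by metis
  define S' where "S' F = W (S (mulop g F))" for F
  have blS': "bounded_linear S'"
    unfolding S'_def by (intro bounded_linear_compose[OF W(1)] bounded_linear_compose[OF S G(1)])
  have "S' (T (R F)) = F" for F
  proof -
    have "mulop g (T (R F)) = R F + X (R F)" by (simp add: X_def)
    then show ?thesis
      using W(2)[of F] SR by (simp add: S'_def linear_add[OF bounded_linear.linear[OF S]])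
  qed
  then have "id = S' \<circ> T \<circ> R" by (auto simp: fun_eq_iff)
  moreover have "onorm R * onorm S' \<le> 1 / \<delta> + \<epsilon>"
  proof -
    have "onorm S' \<le> (1 + \<delta> * \<epsilon>) * (1 / \<delta>)"
    proof (rule onorm_bound)
      fix F
      have "norm (S' F) \<le> onorm W * norm (S (mulop g F))" unfolding S'_def by (rule onorm[OF W(1)])
      also have "\<dots> \<le> (1 + \<delta> * \<epsilon>) * norm (S (mulop g F))"
        using W(3) \<eta>_eq by (intro mult_right_mono) auto
      also have "\<dots> \<le> (1 + \<delta> * \<epsilon>) * (1 / \<delta> * norm F)"
      proof (rule mult_left_mono)
        have "norm (S (mulop g F)) \<le> onorm S * norm (mulop g F)" by (rule onorm[OF S])
        also have "\<dots> \<le> 1 * norm (mulop g F)" using S_le by (intro mult_right_mono) auto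
        also have "\<dots> \<le> 1 / \<delta> * norm F" using G(2) by simp
        finally show "norm (S (mulop g F)) \<le> 1 / \<delta> * norm F" .
      qed (use \<delta> \<epsilon> in auto)
      finally show "norm (S' F) \<le> (1 + \<delta> * \<epsilon>) * (1 / \<delta>) * norm F" by simp
    qed (use \<delta> \<epsilon> in auto)
    also have "\<dots> = 1 / \<delta> + \<epsilon>" using \<delta> by (simp add: field_simps)
    finally have "onorm S' \<le> 1 / \<delta> + \<epsilon>" .
    moreover have "onorm R * onorm S' \<le> 1 * onorm S'"
      using R_le onorm_pos_le[OF blS'] by (intro mult_right_mono) auto
    ultimately show ?thesis by simp
  qed
  ultimately show ?thesis unfolding identity_factors_def using R blS' by blast
qed

theorem corollary6p3:
  shows "factorization_property (\<lambda>\<delta>. 1 / \<delta>) normalized_haar"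
  unfolding factorization_property_def
proof (intro conjI allI impI)
  show "normalized_schauder_basis normalized_haar" by (rule normalized_schauder_basis_haar)
  fix \<delta> :: real and T :: "L1 \<Rightarrow> L1"
  assume \<delta>: "\<delta> > 0" and T: "bounded_linear T"
    and inf: "(INF n. \<bar>biorth normalized_haar n (T (normalized_haar n))\<bar>) \<ge> \<delta>"
  have "\<bar>pair (haar_fun n) (T (haar n))\<bar> \<ge> \<delta> * weight n" for n
  proof -
    have "(INF n. \<bar>biorth normalized_haar n (T (normalized_haar n))\<bar>) \<le> \<bar>biorth normalized_haar n (T (normalized_haar n))\<bar>"
      by (rule cINF_lower) (auto intro!: bdd_belowI[of _ 0])
    then have "\<delta> \<le> \<bar>biorth normalized_haar n (T (normalized_haar n))\<bar>" using inf by linarith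
    also have "\<dots> = \<bar>pair (haar_fun n) (T (haar n))\<bar> / weight n"
      using linear_scale[OF bounded_linear.linear[OF T]]
        linear_scale[OF bounded_linear.linear[OF bounded_linear_pair[OF test_haar_fun]]]
      by (simp add: biorth_normalized_haar normalized_haar_eq abs_mult)
    finally show ?thesis using weight_pos[of n] by (simp add: field_simps)
  qed
  then show "identity_almost_factors (1 / \<delta>) T"
    unfolding identity_almost_factors_def using factor_of_diag[OF T \<delta>] by blast
qed

end
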